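(* Let $f:\mathbb{T}\to\mathbb{R}$ be time-series data with ($N$-truncated) Liouville torus $\Psi_f$. Let $\ell$ be a ray with direction vector $\mathbf a=(a_1,\dots,a_N)$ and endpoint $\mathbf b=(b_1,\dots,b_N)$. Consider a collection of rays $\mathcal L_\ell=\{\ell_1,\dots,\ell_N\}$ associated with $\ell$, where each $\ell_L$ has direction vector $\mathbf a^L=(a_1^L,\dots,a_L,\dots,a_N^L)$ (whose $L$th component is $a_L$) and endpoint $\mathbf b^L=(b_1^L,\dots,b_L,\dots,b_N^L)$ (whose $L$th component is $b_L$), satisfying $\|\mathbf a^L\|=\|\mathbf a\|$ and $$\max_{i\ne L}\frac{r_L^f\sqrt3-b_i^L}{\sqrt N\,a_i^L/\|\mathbf a^L\|}\le\frac{-b_L}{\sqrt N\,a_L/\|\mathbf a^L\|}\qquad\text{for }L=1,\dots,N.$$ Then $$\mathsf{bcd}_0^{\mathcal R,\mathcal L_\ell}(\Psi_f)=\left\{\left(\frac{-b_L}{\sqrt N\,a_L/\|\mathbf a\|},\infty\right):L=1,\dots,N\right\},$$ $$\mathsf{bcd}_1^{\mathcal R,\mathcal L_\ell}(\Psi_f)=\left\{I_1^\ell,\dots,I_N^\ell:\ I_L^\ell=\left(\frac{-b_L}{\sqrt N\,a_L/\|\mathbf a\|},\ \frac{r_L^f\sqrt3-b_L}{\sqrt N\,a_L/\|\mathbf a\|}\right]\right\}.$$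
   Context: For a metric space $(X,d)$ and $\epsilon\in\mathbb{R}$, the Vietoris–Rips complex $\mathcal R_\epsilon(X)$ is the simplicial complex of finite subsets $\{x_0,\dots,x_m\}\subset X$ with $\max_{i,j}d(x_i,x_j)<\epsilon$. The $n$-dimensional barcode of a one-parameter filtration of simplicial complexes is the multiset of intervals $(b,d]$ (or $(b,\infty)$), called bars, each representing an $n$-dimensional homology class (field coefficients) born at $b$ and dying at $d$. The product of simplicial complexes has as vertex set the product of the vertex sets, a finite set being a simplex iff all its coordinate projections are simplices. $\mathbb{T}=\mathbb{R}/2\pi\mathbb{Z}$; $\hat f(L)$ is the $L$th Fourier coefficient of $f$ and $r_L^f=2|\hat f(L)|$. The ($N$-truncated) Liouville torus $\Psi_f$ of $f$ is the Liouville torus of the Hamiltonian $H(\mathbf q,\mathbf p)=\sum_{L=1}^N\frac L2(p_L^2+q_L^2)$ on which, for each $L$, the action $I_L=\frac{p_L^2+q_L^2}{2}$ equals $\frac{(r_L^f)^2}{2}$; it is identified with the product of circles $r_1^f\cdot\mathbb{S}^1\times\cdots\times r_N^f\cdot\mathbb{S}^1$ ($\mathbb{S}^1$ the unit circle with the Euclidean metric), and $\pi_L$ is the projection onto the $L$th circle. A ray with direction vector $\mathbf a=(a_1,\dots,a_N)$, each $a_i>0$, and endpoint $\mathbf b=(b_1,\dots,b_N)\in\mathbb{R}^N$ is $\ell(t)=\mathbf b+\sqrt N\,t\cdot\frac{\mathbf a}{\|\mathbf a\|}$, $t\ge0$ ($\|\cdot\|$ the Euclidean norm). $\mathsf{bcd}_n^{\mathcal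 R,\ell}(\Psi_f)$ is the $n$-dimensional barcode of the one-parameter filtration (with parameter $t$) $$\mathcal R_t^\ell(\Psi_f)=\mathcal R_{b_1+\sqrt N\,t\,a_1/\|\mathbf a\|}(\pi_1\Psi_f)\times\cdots\times\mathcal R_{b_N+\sqrt N\,t\,a_N/\|\mathbf a\|}(\pi_N\Psi_f).$$ For a collection of rays $\mathcal L=\{\ell_1,\dots,\ell_s\}$, $\mathsf{bcd}_n^{\mathcal R,\mathcal L}(\Psi_f)=\bigcup_{i=1}^s\mathsf{bcd}_n^{\mathcal R,\ell_i}(\Psi_f)$.
   Formalization: In the max condition r_L^f is corrected to r_i^f (as printed the claim fails, e.g. N=2, r=(1,10)); empty intervals I_L, which occur when r_L^f=0, are dropped from the 1-dimensional barcode; the filtration parameter t ranges over all reals. *)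

theory Defs
  imports "HOL-Analysis.Analysis" "HOL-Library.Multiset"
begin

section \<open>Simplicial complexes\<close>

text \<open>A simplicial complex is the set of its (nonempty, finite) simplices.\<close>

definition vietoris_rips :: "real \<Rightarrow> 'a::metric_space set \<Rightarrow> 'a set set" where
  "vietoris_rips \<epsilon> X =
     {\<sigma>. finite \<sigma> \<and> \<sigma> \<noteq> {} \<and> \<sigma> \<subseteq> X \<and> (\<forall>x\<in>\<sigma>. \<forall>y\<in>\<sigma>. dist x y < \<epsilon>)}"

definition product_complex :: "'i set \<Rightarrow> ('i \<Rightarrow> 'a set set) \<Rightarrow> ('i \<Rightarrow> 'a) set set" where
  "product_complex I K =
     {\<sigma>. finite \<sigma> \<and> \<sigma> \<noteq> {} \<and> \<sigma> \<subseteq> (\<Pi>\<^sub>E i\<in>I. \<Union>(K i)) \<and> (\<forall>i\<in>I. (\<lambda>x. x i) ` \<sigma> \<in> K i)}"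

section \<open>Simplicial homology with field coefficients\<close>

text \<open>An oriented \<open>n\<close>-chain is a finitely supported function on the orderings
  \<open>[v\<^sub>0, \<dots>, v\<^sub>n]\<close> of the \<open>n\<close>-simplices that changes sign when two
  adjacent vertices are swapped.  The oriented simplex \<open>[v\<^sub>0, \<dots>, v\<^sub>n]\<close> is the
  alternating function with value 1 at that list and 0 at lists with another vertex set.\<close>

definition simplicial_chains :: "'v set set \<Rightarrow> nat \<Rightarrow> ('v list \<Rightarrow> 'k::field) set" where
  "simplicial_chains K n =
     {c. finite {l. c l \<noteq> 0} \<and>
         (\<forall>l. c l \<noteq> 0 \<longrightarrow> length l = Suc n \<and> distinct l \<and> set l \<in> K) \<and>
         (\<forall>xs x y zs. c (xs @ y # x # zs) = - c (xs @ x # y # zs))}"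

text \<open>The coefficient of \<open>l\<close> in \<open>\<Sum>\<^sub>i (-1)\<^sup>i [v\<^sub>0, \<dots>, v\<^sub>i\<^sub>-\<^sub>1, v\<^sub>i\<^sub>+\<^sub>1, \<dots>, v\<^sub>n]\<close>
  is the value of the oriented simplex at \<open>v # l\<close> for the omitted vertex \<open>v\<close>, since moving
  \<open>v\<^sub>i\<close> to the front takes \<open>i\<close> swaps.  The value 0 at the empty list makes the
  boundary of a 0-chain zero, so that homology is not reduced.\<close>

definition simplicial_boundary :: "('v list \<Rightarrow> 'k::field) \<Rightarrow> 'v list \<Rightarrow> 'k" where
  "simplicial_boundary c l = (if l = [] then 0 else \<Sum>v | c (v # l) \<noteq> 0. c (v # l))"

definition simplicial_cycles :: "'v set set \<Rightarrow> nat \<Rightarrow> ('v list \<Rightarrow> 'k::field) set" where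
  "simplicial_cycles K n = {c \<in> simplicial_chains K n. simplicial_boundary c = (\<lambda>_. 0)}"

definition simplicial_boundaries :: "'v set set \<Rightarrow> nat \<Rightarrow> ('v list \<Rightarrow> 'k::field) set" where
  "simplicial_boundaries K n = simplicial_boundary ` simplicial_chains K (Suc n)"

section \<open>Barcodes\<close>

text \<open>The persistence module \<open>t \<mapsto> H\<^sub>n(K t)\<close> of a filtration \<open>K\<close> indexed by the reals
  is the direct sum of the interval modules of the bars \<open>Is ! 0, Is ! 1, \<dots>\<close>.  The isomorphism
  is given by the images of the canonical generators of the interval modules: for each bar and
  each \<open>t\<close> in it a class, represented by the cycle \<open>e i t\<close>, such that the classes of a bar
  are mapped to each other as long as they stay in the bar and to 0 afterwards, and
  such that at each \<open>t\<close> the classes of the bars containing \<open>t\<close> are a basis of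
  \<open>H\<^sub>n(K t)\<close>, the quotient of the cycles by the boundaries.  Bars are nonempty.\<close>

definition is_barcode ::
    "'k::field itself \<Rightarrow> nat \<Rightarrow> (real \<Rightarrow> 'v set set) \<Rightarrow> real set multiset \<Rightarrow> bool" where
  "is_barcode _ n K B \<longleftrightarrow>
     (\<exists>Is (e :: nat \<Rightarrow> real \<Rightarrow> 'v list \<Rightarrow> 'k).
        mset Is = B \<and>
        (\<forall>i<length Is. is_interval (Is ! i) \<and> Is ! i \<noteq> {}) \<and>
        (\<forall>i<length Is. \<forall>t\<in>Is ! i. e i t \<in> simplicial_cycles (K t) n) \<and>
        (\<forall>i<length Is. \<forall>s\<in>Is ! i. \<forall>t\<in>Is ! i. s \<le> t \<longrightarrow>
           (\<lambda>l. e i s l - e i t l) \<in> simplicial_boundaries (K t) n) \<and>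
        (\<forall>i<length Is. \<forall>s\<in>Is ! i. \<forall>t. t \<notin> Is ! i \<longrightarrow> s \<le> t \<longrightarrow>
           e i s \<in> simplicial_boundaries (K t) n) \<and>
        (\<forall>t. \<forall>z\<in>simplicial_cycles (K t) n. \<exists>!\<alpha> :: nat \<Rightarrow> 'k.
           (\<forall>i. \<alpha> i \<noteq> 0 \<longrightarrow> i < length Is \<and> t \<in> Is ! i) \<and>
           (\<lambda>l. z l - (\<Sum>i | i < length Is \<and> t \<in> Is ! i. \<alpha> i * e i t l))
             \<in> simplicial_boundaries (K t) n))"

definition barcode ::
    "'k::field itself \<Rightarrow> nat \<Rightarrow> (real \<Rightarrow> 'v set set) \<Rightarrow> real set multiset" where
  "barcode k n K = (THE B. is_barcode k n K B)"

section \<open>The Liouville torus of a time series\<close>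

text \<open>A function on the circle group of reals modulo \<open>2\<pi>\<close> is
  a \<open>2\<pi>\<close>-periodic function on the reals.\<close>

definition fourier_coefficient :: "(real \<Rightarrow> real) \<Rightarrow> nat \<Rightarrow> complex" where
  "fourier_coefficient f L =
     (LINT x:{0..2 * pi}|lebesgue. complex_of_real (f x) * cis (- (real L * x)))
       / complex_of_real (2 * pi)"

definition torus_radius :: "(real \<Rightarrow> real) \<Rightarrow> nat \<Rightarrow> real" where
  "torus_radius f L = 2 * cmod (fourier_coefficient f L)"

text \<open>A point \<open>x\<close> of the phase space has the coordinates
  \<open>x L = (q\<^sub>L, p\<^sub>L)\<close> for \<open>L = 1, \<dots>, N\<close>.  The metric of \<^typ>\<open>real \<times> real\<close>
  is the Euclidean one.\<close>

definition action :: "nat \<Rightarrow> (nat \<Rightarrow> real \<times> real) \<Rightarrow> real" where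
  "action L x = ((snd (x L))\<^sup>2 + (fst (x L))\<^sup>2) / 2"

text \<open>The Hamiltonian \<open>\<Sum>\<^sub>L L / 2 * (p\<^sub>L\<^sup>2 + q\<^sub>L\<^sup>2)\<close> equals \<open>\<Sum>\<^sub>L L * action L\<close>;
  its Liouville tori are the common level sets of the actions.\<close>

definition liouville_torus :: "nat \<Rightarrow> (real \<Rightarrow> real) \<Rightarrow> (nat \<Rightarrow> real \<times> real) set" where
  "liouville_torus N f =
     {x \<in> extensional {1..N}. \<forall>L\<in>{1..N}. action L x = (torus_radius f L)\<^sup>2 / 2}"

section \<open>Barcodes along rays\<close>

text \<open>A ray is the pair of its direction vector and its endpoint, both indexed by
  \<open>{1..N}\<close>.\<close>

type_synonym ray = "(nat \<Rightarrow> real) \<times> (nat \<Rightarrow> real)"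

definition ray_point :: "nat \<Rightarrow> ray \<Rightarrow> real \<Rightarrow> nat \<Rightarrow> real" where
  "ray_point N = (\<lambda>(a, b) t i. b i + sqrt (real N) * t * (a i / L2_set a {1..N}))"

text \<open>The parameter \<open>t\<close> of the filtration ranges over all reals: a bar may be born at a
  negative value if the endpoint of the ray has positive coordinates.\<close>

definition ray_filtration ::
    "nat \<Rightarrow> ray \<Rightarrow> (nat \<Rightarrow> 'a::metric_space) set \<Rightarrow> real \<Rightarrow> (nat \<Rightarrow> 'a) set set" where
  "ray_filtration N \<l> X t =
     product_complex {1..N} (\<lambda>L. vietoris_rips (ray_point N \<l> t L) ((\<lambda>x. x L) ` X))"

definition bcd_ray ::
    "'k::field itself \<Rightarrow> nat \<Rightarrow> nat \<Rightarrow> ray \<Rightarrow> (nat \<Rightarrow> 'a::metric_space) set \<Rightarrow> real set multiset" where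
  "bcd_ray k n N \<l> X = barcode k n (ray_filtration N \<l> X)"

text \<open>The union of the barcodes of the rays \<open>\<l>s 1, \<dots>, \<l>s s\<close> counts multiplicities.\<close>

definition bcd_rays ::
    "'k::field itself \<Rightarrow> nat \<Rightarrow> nat \<Rightarrow> nat \<Rightarrow> (nat \<Rightarrow> ray) \<Rightarrow> (nat \<Rightarrow> 'a::metric_space) set
      \<Rightarrow> real set multiset" where
  "bcd_rays k n N s \<l>s X = (\<Sum>i = 1..s. bcd_ray k n N (\<l>s i) X)"

end

theory Submission
  imports Defs "HOL-Library.Function_Algebras"
begin

text \<open>Beyond the birth time of the \<open>L\<close>th ray, every factor except the \<open>L\<close>th has scale larger than the
  side of an inscribed equilateral triangle, so its circle has no first homology, although it need
  not be contractible: its Rips complex may be an odd sphere of dimension at least 3. The \<open>L\<close>th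
  circle carries a class exactly until its own scale exceeds this side.

  Homology is computed by duality. A 1-cocycle on the torus lifts to Euclidean space, where it is a
  coboundary; it is determined up to coboundaries by its periods, and the period of a direction
  vanishes once the equilateral triangle in that direction is a simplex. What remains is the
  multiple of one cocycle, the number of crossings of a branch cut of the \<open>L\<close>th angle. Hence at
  every parameter the homology is zero or one-dimensional and is detected by a fixed functional,
  which forces the barcode to consist of at most one bar.\<close>

section \<open>Linear algebra of finitely supported functions\<close>

text \<open>Filling a cycle by hand would need explicit chains on an infinite complex. The dual side
  is easier: a functional that vanishes on boundaries restricts to a cocycle on edges, and a cocycle
  can be summed along straight segments upstairs, where the displacements that project to edges form
  a box around 0. Edges are all that matters. Rips complexes and their products are determined by
  their edges, so the filtration is a family of clique complexes, and three pairwise adjacent points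
  always span a triangle. The constant sqrt 3 is the ratio of side to radius in an inscribed
  equilateral triangle. Up to this side length three edges cannot go around the circle, so the
  crossing count is a cocycle; beyond it three edges do go around and bound. Since Rips distances
  are strict, the equilateral triangle is not yet a simplex at the critical scale, and there are no
  vertices at scale 0: this makes the bars closed on the right and open on the left.\<close>

definition scl :: "'k::field \<Rightarrow> ('a \<Rightarrow> 'k) \<Rightarrow> 'a \<Rightarrow> 'k" where
  "scl a c = (\<lambda>l. a * c l)"

lemma scl_apply [simp]: "scl a c l = a * c l"
  by (simp add: scl_def)

lemma vector_space_scl: "vector_space scl"
  by standard (auto simp: fun_eq_iff algebra_simps)

lemma vector_space_mult: "vector_space ((*) :: 'k::field \<Rightarrow> 'k \<Rightarrow> 'k)"
  by standard (auto simp: algebra_simps)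

text \<open>This is the duality step. A basis of the subspace \<open>B\<close> stays independent
  when \<open>z\<close> is added, so the map that is 1 at \<open>z\<close> and 0 on the basis
  extends linearly. Nothing of finite dimension is required, as chain spaces of the torus are
  huge.\<close>

lemma separating_functional:
  fixes B :: "('a \<Rightarrow> 'k::field) set"
  assumes 0: "0 \<in> B" and B: "\<And>c d a. c \<in> B \<Longrightarrow> d \<in> B \<Longrightarrow> c + scl a d \<in> B" and z: "z \<notin> B"
  obtains F :: "('a \<Rightarrow> 'k) \<Rightarrow> 'k"
    where "\<And>c d a. F (c + scl a d) = F c + a * F d" "\<And>c. c \<in> B \<Longrightarrow> F c = 0" "F z = 1"
proof -
  interpret V: vector_space "scl :: 'k \<Rightarrow> ('a \<Rightarrow> 'k) \<Rightarrow> _" by (rule vector_space_scl)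
  interpret P: vector_space_pair "scl :: 'k \<Rightarrow> ('a \<Rightarrow> 'k) \<Rightarrow> _" "(*) :: 'k \<Rightarrow> _"
    by (intro vector_space_pair.intro vector_space_scl vector_space_mult)
  have sub: "V.subspace B"
    unfolding V.subspace_def
  proof (intro conjI ballI allI)
    fix x y assume "x \<in> B" "y \<in> B"
    then show "x + y \<in> B" using B[of x y 1] by (simp add: scl_def)
  next
    fix c x assume "x \<in> B"
    then show "scl c x \<in> B" using B[OF 0, of x c] by simp
  qed (rule 0)
  obtain B0 where B0: "B0 \<subseteq> B" "V.independent B0" "B \<subseteq> V.span B0"
    using V.maximal_independent_subset by blast
  have "z \<notin> V.span B0" using V.span_minimal[OF B0(1) sub] z by blast
  then have ind: "V.independent (insert z B0)" using B0(2) by (rule V.independent_insertI)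
  obtain F where lin: "Vector_Spaces.linear scl (*) F"
      and F: "\<forall>x\<in>insert z B0. F x = (if x = z then 1 else (0 :: 'k))"
    using P.linear_independent_extend[OF ind, of "\<lambda>x. if x = z then 1 else 0"] by blast
  interpret F: Vector_Spaces.linear scl "(*)" F by (rule lin)
  show ?thesis
  proof
    show "F (c + scl a d) = F c + a * F d" for c d a
      by (simp add: F.add F.scale)
    have "F x = 0" if "x \<in> B0" for x
      using F that B0(1) z by auto
    then have "F x = 0" if "x \<in> V.span B0" for x
      by (rule P.linear_eq_0_on_span[OF lin _ that])
    then show "F c = 0" if "c \<in> B" for c
      using that B0(3) by blast
    show "F z = 1" using F by simp
  qed
qed

section \<open>Finitely supported functions and their pairing with cochains\<close>

definition finsupp :: "('a \<Rightarrow> 'k::zero) \<Rightarrow> bool" where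
  "finsupp c \<longleftrightarrow> finite {l. c l \<noteq> 0}"

definition single :: "'a \<Rightarrow> 'a \<Rightarrow> 'k::field" where
  "single m = (\<lambda>l. of_bool (l = m))"

lemma finsupp_0 [simp]: "finsupp (0 :: 'a \<Rightarrow> 'k::field)"
  by (simp add: finsupp_def)

lemma finsupp_single [simp]: "finsupp (single m)"
  by (simp add: finsupp_def single_def)

lemma finsupp_scl [simp]: "finsupp c \<Longrightarrow> finsupp (scl a c)"
  unfolding finsupp_def by (rule finite_subset[rotated]) auto

lemma finsupp_add [simp]:
  fixes c d :: "'a \<Rightarrow> 'k::field"
  assumes "finsupp c" "finsupp d" shows "finsupp (c + d)"
proof -
  have "{l. (c + d) l \<noteq> 0} \<subseteq> {l. c l \<noteq> 0} \<union> {l. d l \<noteq> 0}" by auto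
  then show ?thesis using assms unfolding finsupp_def by (meson finite_UnI finite_subset)
qed

lemma diff_eq_add_scl: "c - d = c + scl (- 1) (d :: 'a \<Rightarrow> 'k::field)"
  by (simp add: fun_eq_iff)

lemma finsupp_diff [simp]:
  "finsupp c \<Longrightarrow> finsupp d \<Longrightarrow> finsupp (c - d :: 'a \<Rightarrow> 'k::field)"
  by (simp add: diff_eq_add_scl)

text \<open>Linearity is demanded only on finitely supported functions: \<open>pairing\<close> sums
  over the support, and a sum over an infinite set is 0 by convention, which breaks
  additivity.\<close>

definition fin_linear :: "(('a \<Rightarrow> 'k::field) \<Rightarrow> 'k) \<Rightarrow> bool" where
  "fin_linear \<Phi> \<longleftrightarrow> (\<forall>c d a. finsupp c \<longrightarrow> finsupp d \<longrightarrow> \<Phi> (c + scl a d) = \<Phi> c + a * \<Phi> d)"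

lemma fin_linear_0:
  assumes "fin_linear \<Phi>" shows "\<Phi> 0 = 0"
proof -
  have "\<Phi> (0 + scl 1 0) = \<Phi> 0 + 1 * \<Phi> 0"
    using assms finsupp_0 unfolding fin_linear_def by blast
  moreover have "(0 :: 'a \<Rightarrow> 'b) + scl 1 0 = 0" by (simp add: fun_eq_iff)
  ultimately have "\<Phi> 0 = \<Phi> 0 + \<Phi> 0" by (simp only: mult_1)
  then show ?thesis by (simp only: add_cancel_right_right)
qed

lemma fin_linear_add:
  assumes "fin_linear \<Phi>" "finsupp c" "finsupp d"
  shows "\<Phi> (c + d) = \<Phi> c + \<Phi> d"
proof -
  have "\<Phi> (c + scl 1 d) = \<Phi> c + 1 * \<Phi> d" using assms unfolding fin_linear_def by blast
  then show ?thesis by (simp add: scl_def)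
qed

lemma fin_linear_diff:
  assumes "fin_linear \<Phi>" "finsupp c" "finsupp d"
  shows "\<Phi> (c - d) = \<Phi> c - \<Phi> d"
proof -
  have "\<Phi> (c + scl (- 1) d) = \<Phi> c + (- 1) * \<Phi> d" using assms unfolding fin_linear_def by blast
  then show ?thesis by (simp add: diff_eq_add_scl)
qed

lemma fin_linear_cmult: "fin_linear \<Phi> \<Longrightarrow> fin_linear (\<lambda>c. b * \<Phi> c)"
  by (simp add: fin_linear_def distrib_left mult.left_commute)

lemma fin_linear_plus: "fin_linear \<Phi> \<Longrightarrow> fin_linear \<Psi> \<Longrightarrow> fin_linear (\<lambda>c. \<Phi> c + \<Psi> c)"
  by (simp add: fin_linear_def distrib_left add_ac)

text \<open>The cochain \<open>\<phi>\<close> need not be alternating. On oriented chains it acts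
  through its antisymmetrisation, which is why \<open>\<phi> [x, y] - \<phi> [y, x]\<close> appears
  throughout.\<close>

definition pairing :: "('a \<Rightarrow> 'k::field) \<Rightarrow> ('a \<Rightarrow> 'k) \<Rightarrow> 'k" where
  "pairing \<phi> c = (\<Sum>l | c l \<noteq> 0. \<phi> l * c l)"

lemma pairing_superset:
  assumes "finite S" "{l. c l \<noteq> 0} \<subseteq> S"
  shows "pairing \<phi> c = (\<Sum>l\<in>S. \<phi> l * c l)"
  unfolding pairing_def using assms by (intro sum.mono_neutral_left) auto

lemma fin_linear_pairing: "fin_linear (pairing \<phi>)"
  unfolding fin_linear_def
proof (intro allI impI)
  fix c d :: "'a \<Rightarrow> 'b" and a
  assume fin: "finsupp c" "finsupp d"
  let ?S = "{l. c l \<noteq> 0} \<union> {l. d l \<noteq> 0}"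
  have S: "finite ?S" using fin by (simp add: finsupp_def)
  have "{l. (c + scl a d) l \<noteq> 0} \<subseteq> ?S" by auto
  then have "pairing \<phi> (c + scl a d) = (\<Sum>l\<in>?S. \<phi> l * (c + scl a d) l)"
    by (rule pairing_superset[OF S])
  also have "\<dots> = (\<Sum>l\<in>?S. \<phi> l * c l) + a * (\<Sum>l\<in>?S. \<phi> l * d l)"
    by (simp add: algebra_simps sum.distrib sum_distrib_left)
  also have "\<dots> = pairing \<phi> c + a * pairing \<phi> d"
    by (subst (1 2) pairing_superset[OF S]) auto
  finally show "pairing \<phi> (c + scl a d) = pairing \<phi> c + a * pairing \<phi> d" .
qed

lemma pairing_single [simp]: "pairing \<phi> (single m) = \<phi> m"
  by (subst pairing_superset[of "{m}"]) (auto simp: single_def)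

section \<open>Chains in low degrees\<close>

lemma simplicial_chainsD:
  assumes "c \<in> simplicial_chains K n"
  shows "finsupp c"
    and "c l \<noteq> 0 \<Longrightarrow> length l = Suc n \<and> distinct l \<and> set l \<in> K"
    and "c (xs @ y # x # zs) = - c (xs @ x # y # zs)"
  using assms unfolding simplicial_chains_def finsupp_def by blast+

lemma simplicial_chains_0: "0 \<in> simplicial_chains K n"
  by (simp add: simplicial_chains_def)

lemma simplicial_chains_lincomb:
  assumes c: "c \<in> simplicial_chains K n" and d: "d \<in> simplicial_chains K n"
  shows "c + scl a d \<in> simplicial_chains K n"
proof -
  note c = simplicial_chainsD[OF c] and d = simplicial_chainsD[OF d]
  have "finsupp (c + scl a d)" using c(1) d(1) by simp
  moreover have "length l = Suc n \<and> distinct l \<and> set l \<in> K" if "(c + scl a d) l \<noteq> 0" for l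
  proof -
    have "c l \<noteq> 0 \<or> d l \<noteq> 0" using that by auto
    then show ?thesis using c(2) d(2) by blast
  qed
  moreover have "(c + scl a d) (xs @ y # x # zs) = - (c + scl a d) (xs @ x # y # zs)" for xs x y zs
    by (simp only: plus_fun_apply scl_apply c(3)[of xs y x] d(3)[of xs y x]) simp
  ultimately show ?thesis unfolding simplicial_chains_def finsupp_def by blast
qed

lemma simplicial_chains_mono: "K \<subseteq> K' \<Longrightarrow> simplicial_chains K n \<subseteq> simplicial_chains K' n"
  unfolding simplicial_chains_def by blast

text \<open>Subtracting \<open>c l\<close> times the oriented simplex \<open>\<tau> l\<close>
  removes \<open>l\<close> from the support of \<open>c\<close> and, by \<open>supp\<close>, adds
  nothing to it, so induction on the size of the support applies. No preferred ordering of the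
  vertices of a simplex has to be chosen.\<close>

lemma simplicial_chains_eqI:
  fixes \<Phi> \<Psi> :: "('v list \<Rightarrow> 'k::field) \<Rightarrow> 'k"
  assumes c: "c \<in> simplicial_chains K n" and "fin_linear \<Phi>" "fin_linear \<Psi>"
    and \<tau>: "\<And>l. length l = Suc n \<Longrightarrow> distinct l \<Longrightarrow> set l \<in> K \<Longrightarrow>
      \<tau> l \<in> simplicial_chains K n \<and> \<tau> l l = 1 \<and> \<Phi> (\<tau> l) = \<Psi> (\<tau> l)"
    and supp: "\<And>l m (c :: 'v list \<Rightarrow> 'k). \<tau> l m \<noteq> 0 \<Longrightarrow> c \<in> simplicial_chains K n \<Longrightarrow> c l \<noteq> 0 \<Longrightarrow> c m \<noteq> 0"
  shows "\<Phi> c = \<Psi> c"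
  using c
proof (induction "card {l. c l \<noteq> 0}" arbitrary: c rule: less_induct)
  case less
  note c = simplicial_chainsD[OF less.prems]
  show ?case
  proof (cases "\<exists>l. c l \<noteq> 0")
    case False
    then have "c = 0" by (simp add: fun_eq_iff)
    then show ?thesis using assms(2,3) by (simp add: fin_linear_0)
  next
    case True
    then obtain l where l: "c l \<noteq> 0" by blast
    have \<tau>l: "\<tau> l \<in> simplicial_chains K n" "\<tau> l l = 1" "\<Phi> (\<tau> l) = \<Psi> (\<tau> l)"
      using \<tau> c(2)[OF l] by blast+
    let ?c = "c + scl (- c l) (\<tau> l)"
    have c': "?c \<in> simplicial_chains K n" using less.prems \<tau>l(1) by (rule simplicial_chains_lincomb)
    have "{m. ?c m \<noteq> 0} \<subseteq> {m. c m \<noteq> 0}" using supp[OF _ less.prems l] by auto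
    moreover have "?c l = 0" using \<tau>l by simp
    ultimately have "{m. ?c m \<noteq> 0} \<subset> {m. c m \<noteq> 0}" using l by blast
    then have "card {m. ?c m \<noteq> 0} < card {m. c m \<noteq> 0}"
      using c(1) unfolding finsupp_def by (simp add: psubset_card_mono)
    then have "\<Phi> ?c = \<Psi> ?c" using less.hyps c' by blast
    moreover have "\<Phi> ?c = \<Phi> c + (- c l) * \<Phi> (\<tau> l)" "\<Psi> ?c = \<Psi> c + (- c l) * \<Psi> (\<tau> l)"
      using assms(2,3) c(1) simplicial_chainsD(1)[OF \<tau>l(1)] unfolding fin_linear_def by blast+
    ultimately show ?thesis using \<tau>l(3) by simp
  qed
qed

section \<open>Oriented edges and triangles\<close>

definition oedge :: "'v \<Rightarrow> 'v \<Rightarrow> 'v list \<Rightarrow> 'k::field" where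
  "oedge x y = single [x, y] - single [y, x]"

definition otriangle :: "'v \<Rightarrow> 'v \<Rightarrow> 'v \<Rightarrow> 'v list \<Rightarrow> 'k::field" where
  "otriangle x y z = single [x, y, z] + single [y, z, x] + single [z, x, y]
     - single [y, x, z] - single [x, z, y] - single [z, y, x]"

lemma oedge_refl [simp]: "oedge x x = 0"
  by (simp add: oedge_def)

lemma oedge_swap: "oedge y x = - (oedge x y)"
  by (simp add: oedge_def)

lemma finsupp_oedge [simp]: "finsupp (oedge x y)"
  by (simp add: oedge_def)

lemma single_in_chains: "{x} \<in> K \<Longrightarrow> single [x] \<in> simplicial_chains K 0"
  by (auto simp: simplicial_chains_def single_def append_eq_Cons_conv)

lemma oedge_in_chains:
  assumes "x \<noteq> y" "{x, y} \<in> K" shows "oedge x y \<in> simplicial_chains K 1"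
proof -
  have "finite {l. oedge x y l \<noteq> 0}" using finsupp_oedge unfolding finsupp_def .
  moreover have "length l = Suc 1 \<and> distinct l \<and> set l \<in> K" if "oedge x y l \<noteq> 0" for l
  proof -
    have "l = [x, y] \<or> l = [y, x]" using that by (auto simp: oedge_def single_def)
    then show ?thesis using assms by (auto simp: insert_commute)
  qed
  moreover have "oedge x y (xs @ v # u # zs) = - oedge x y (xs @ u # v # zs)" for xs u v zs
    by (cases xs) (simp_all add: oedge_def single_def conj_ac)
  ultimately show ?thesis unfolding simplicial_chains_def by blast
qed

text \<open>Moving a swap from the argument to the index turns the sign rule for
  \<open>otriangle\<close> into a permutation of its six terms.\<close>

lemma single_swap: "single (a # b # l) (u # v # m) = single (b # a # l) (v # u # m)"
  by (auto simp: single_def)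

lemma single_swap2: "single (a # b # c # l) (w # u # v # m) = single (a # c # b # l) (w # v # u # m)"
  by (auto simp: single_def)

lemma otriangle_support:
  assumes "otriangle x y z l \<noteq> 0"
  shows "l \<in> {[x, y, z], [y, z, x], [z, x, y], [y, x, z], [x, z, y], [z, y, x]}"
proof (rule ccontr)
  assume "l \<notin> {[x, y, z], [y, z, x], [z, x, y], [y, x, z], [x, z, y], [z, y, x]}"
  then have "otriangle x y z l = 0" by (simp add: otriangle_def single_def)
  with assms show False by contradiction
qed

lemma otriangle_self: "distinct [x, y, z] \<Longrightarrow> otriangle x y z [x, y, z] = 1"
  by (simp add: otriangle_def single_def)

lemma otriangle_in_chains:
  assumes "distinct [x, y, z]" "{x, y, z} \<in> K" shows "otriangle x y z \<in> simplicial_chains K 2"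
proof -
  have "finsupp (otriangle x y z)" by (simp add: otriangle_def)
  then have "finite {l. otriangle x y z l \<noteq> 0}" unfolding finsupp_def .
  moreover have "length l = Suc 2 \<and> distinct l \<and> set l \<in> K" if "otriangle x y z l \<noteq> 0" for l
  proof -
    have "l \<in> {[x, y, z], [y, z, x], [z, x, y], [y, x, z], [x, z, y], [z, y, x]}"
      using otriangle_support[OF that] .
    then show ?thesis using assms by (auto simp: insert_commute)
  qed
  moreover have "otriangle x y z (xs @ v # u # zs) = - otriangle x y z (xs @ u # v # zs)" for xs u v zs
  \<comment> \<open>The swap acts on the first two positions if \<open>xs\<close> is empty and on
    the last two if \<open>xs\<close> has one entry. For longer \<open>xs\<close> the list is longer
    than any ordering of the triangle, and both sides are 0.\<close>
  proof (cases xs)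
    case Nil
    show ?thesis
      unfolding Nil append_Nil otriangle_def plus_fun_apply fun_diff_def single_swap[of _ _ _ v u]
      by (simp add: algebra_simps)
  next
    case (Cons w ws)
    show ?thesis
    proof (cases ws)
      case Nil
      show ?thesis
        unfolding Cons Nil append_Nil append_Cons otriangle_def plus_fun_apply fun_diff_def
          single_swap2[of _ _ _ _ w v u]
        by (simp add: algebra_simps)
    qed (simp add: Cons otriangle_def single_def)
  qed
  ultimately show ?thesis unfolding simplicial_chains_def by blast
qed

lemma simplicial_chains0_eqI:
  assumes "c \<in> simplicial_chains K 0" "fin_linear \<Phi>" "fin_linear \<Psi>"
    and "\<And>x. {x} \<in> K \<Longrightarrow> \<Phi> (single [x]) = \<Psi> (single [x])"
  shows "\<Phi> c = \<Psi> c"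
proof (rule simplicial_chains_eqI[where \<tau> = single, OF assms(1-3)])
  fix l :: "'a list" assume "length l = Suc 0" "set l \<in> K"
  then show "single l \<in> simplicial_chains K 0 \<and> single l l = (1 :: 'b) \<and> \<Phi> (single l) = \<Psi> (single l)"
    using assms(4) single_in_chains by (cases l) (auto, auto simp: single_def)
qed (auto simp: single_def split: if_splits)

lemma simplicial_chains1_eqI:
  assumes "c \<in> simplicial_chains K 1" "fin_linear \<Phi>" "fin_linear \<Psi>"
    and "\<And>x y. x \<noteq> y \<Longrightarrow> {x, y} \<in> K \<Longrightarrow> \<Phi> (oedge x y) = \<Psi> (oedge x y)"
  shows "\<Phi> c = \<Psi> c"
proof (rule simplicial_chains_eqI[where \<tau> = "\<lambda>l. if length l = 2 then oedge (l ! 0) (l ! 1) else 0", OF assms(1-3)])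
  fix l :: "'a list" assume "length l = Suc 1" "distinct l" "set l \<in> K"
  then obtain x y where l: "l = [x, y]" "x \<noteq> y" "{x, y} \<in> K"
    by (auto simp: length_Suc_conv)
  let ?\<tau> = "if length l = 2 then oedge (l ! 0) (l ! 1) else 0"
  show "?\<tau> \<in> simplicial_chains K 1 \<and> ?\<tau> l = (1 :: 'b) \<and> \<Phi> ?\<tau> = \<Psi> ?\<tau>"
    using assms(4)[OF l(2,3)] oedge_in_chains[OF l(2,3)] l
    by simp (auto simp: oedge_def single_def)
next
  fix l m :: "'a list" and d
  assume \<tau>: "(if length l = 2 then oedge (l ! 0) (l ! 1) else 0) m \<noteq> (0 :: 'b)"
    and d: "d \<in> simplicial_chains K 1" "d l \<noteq> 0"
  obtain x y where l: "l = [x, y]"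
    using simplicial_chainsD(2)[OF d] by (auto simp: length_Suc_conv)
  have "m = [x, y] \<or> m = [y, x]" using \<tau> l by (auto simp: oedge_def single_def split: if_splits)
  moreover have "d [y, x] = - d [x, y]"
    using simplicial_chainsD(3)[OF d(1), of "[]" y x "[]"] by simp
  ultimately show "d m \<noteq> 0" using d(2) l by auto
qed

lemma simplicial_chains2_eqI:
  assumes "c \<in> simplicial_chains K 2" "fin_linear \<Phi>" "fin_linear \<Psi>"
    and "\<And>x y z. distinct [x, y, z] \<Longrightarrow> {x, y, z} \<in> K \<Longrightarrow> \<Phi> (otriangle x y z) = \<Psi> (otriangle x y z)"
  shows "\<Phi> c = \<Psi> c"
proof (rule simplicial_chains_eqI[where \<tau> = "\<lambda>l. if length l = 3 then otriangle (l ! 0) (l ! 1) (l ! 2) else 0", OF assms(1-3)])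
  fix l :: "'a list" assume "length l = Suc 2" "distinct l" "set l \<in> K"
  then obtain x y z where l: "l = [x, y, z]" "distinct [x, y, z]" "{x, y, z} \<in> K"
    by (auto simp: length_Suc_conv numeral_2_eq_2)
  let ?\<tau> = "if length l = 3 then otriangle (l ! 0) (l ! 1) (l ! 2) else 0"
  show "?\<tau> \<in> simplicial_chains K 2 \<and> ?\<tau> l = (1 :: 'b) \<and> \<Phi> ?\<tau> = \<Psi> ?\<tau>"
    using assms(4)[OF l(2,3)] otriangle_in_chains[OF l(2,3)] l
    by (simp add: otriangle_self)
next
  fix l m :: "'a list" and d
  assume \<tau>: "(if length l = 3 then otriangle (l ! 0) (l ! 1) (l ! 2) else 0) m \<noteq> (0 :: 'b)"
    and d: "d \<in> simplicial_chains K 2" "d l \<noteq> 0"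
  obtain x y z where l: "l = [x, y, z]"
    using simplicial_chainsD(2)[OF d] by (auto simp: length_Suc_conv numeral_2_eq_2)
  have m: "m \<in> {[x, y, z], [y, z, x], [z, x, y], [y, x, z], [x, z, y], [z, y, x]}"
    using otriangle_support[of x y z m] \<tau> l by simp
  have 1: "d [v, u, w] = - d [u, v, w]" for u v w
    using simplicial_chainsD(3)[OF d(1), of "[]" v u "[w]"] by simp
  have 2: "d [w, v, u] = - d [w, u, v]" for u v w
    using simplicial_chainsD(3)[OF d(1), of "[w]" v u "[]"] by simp
  show "d m \<noteq> 0" using m d(2) l 1 2 by (metis insertE neg_equal_0_iff_equal singletonD)
qed

section \<open>The boundary operator\<close>

text \<open>Summing over the vertices put in front of \<open>l\<close> is summing over the lists
  with tail \<open>l\<close>. In this form the boundary inherits linearity from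
  \<open>pairing\<close>.\<close>

lemma simplicial_boundary_eq_pairing:
  assumes "finsupp c" "l \<noteq> []"
  shows "simplicial_boundary c l = pairing (\<lambda>m. of_bool (m \<noteq> [] \<and> tl m = l)) c"
proof -
  have "pairing (\<lambda>m. of_bool (m \<noteq> [] \<and> tl m = l)) c
      = (\<Sum>m | c m \<noteq> 0. if m \<in> (\<lambda>v. v # l) ` {v. c (v # l) \<noteq> 0} then c m else 0)"
    unfolding pairing_def
  proof (rule sum.cong[OF refl])
    fix m assume "m \<in> {m. c m \<noteq> 0}"
    then show "of_bool (m \<noteq> [] \<and> tl m = l) * c m
        = (if m \<in> (\<lambda>v. v # l) ` {v. c (v # l) \<noteq> 0} then c m else 0)"
      by (cases m) auto
  qed
  also have "\<dots> = (\<Sum>m \<in> {m. c m \<noteq> 0} \<inter> (\<lambda>v. v # l) ` {v. c (v # l) \<noteq> 0}. c m)"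
    using assms(1) by (subst sum.inter_restrict) (auto simp: finsupp_def)
  also have "{m. c m \<noteq> 0} \<inter> (\<lambda>v. v # l) ` {v. c (v # l) \<noteq> 0} = (\<lambda>v. v # l) ` {v. c (v # l) \<noteq> 0}"
    by auto
  also have "(\<Sum>m \<in> (\<lambda>v. v # l) ` {v. c (v # l) \<noteq> 0}. c m) = (\<Sum>v | c (v # l) \<noteq> 0. c (v # l))"
    by (subst sum.reindex) (auto simp: inj_on_def)
  finally show ?thesis using assms(2) by (simp add: simplicial_boundary_def)
qed

lemma boundary_lincomb:
  assumes "finsupp c" "finsupp d"
  shows "simplicial_boundary (c + scl a d) = simplicial_boundary c + scl a (simplicial_boundary d)"
proof
  fix l
  show "simplicial_boundary (c + scl a d) l = (simplicial_boundary c + scl a (simplicial_boundary d)) l"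
  proof (cases "l = []")
    case True
    then show ?thesis by (simp add: simplicial_boundary_def)
  next
    case False
    have "pairing \<phi> (c + scl a d) = pairing \<phi> c + a * pairing \<phi> d" for \<phi>
      using assms fin_linear_pairing[of \<phi>] unfolding fin_linear_def by blast
    then show ?thesis
      using assms False by (simp add: simplicial_boundary_eq_pairing del: of_bool_conj)
  qed
qed

lemma boundary_0 [simp]: "simplicial_boundary 0 = 0"
  by (simp add: simplicial_boundary_def fun_eq_iff)

lemma boundary_add:
  "finsupp c \<Longrightarrow> finsupp d \<Longrightarrow> simplicial_boundary (c + d) = simplicial_boundary c + simplicial_boundary d"
  using boundary_lincomb[of c d 1] by (simp add: scl_def)

lemma boundary_diff:
  "finsupp c \<Longrightarrow> finsupp d \<Longrightarrow> simplicial_boundary (c - d) = simplicial_boundary c - simplicial_boundary d"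
  using boundary_lincomb[of c d "- 1"] by (simp add: diff_eq_add_scl)

text \<open>For nonempty \<open>l\<close> the function \<open>single (v # l)\<close> is not
  alternating, hence no chain, but the boundary formula drops the head of any list. Boundaries of
  oriented simplices can therefore be computed term by term.\<close>

lemma boundary_single: "simplicial_boundary (single (v # l)) = (if l = [] then 0 else single l)"
proof
  fix m :: "'a list"
  show "simplicial_boundary (single (v # l)) m = (if l = [] then 0 else single l) m"
    by (cases "m = []") (auto simp: simplicial_boundary_eq_pairing, auto simp: single_def simplicial_boundary_def)
qed

lemma boundary_oedge: "simplicial_boundary (oedge x y) = single [y] - single [x]"
  by (simp add: oedge_def boundary_diff boundary_single)

lemma boundary_otriangle:
  "simplicial_boundary (otriangle x y z) = oedge y z + oedge z x + oedge x y"
  by (simp add: otriangle_def oedge_def boundary_diff boundary_add boundary_single algebra_simps)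

lemma finsupp_boundary [simp]: "finsupp c \<Longrightarrow> finsupp (simplicial_boundary c)"
proof -
  assume c: "finsupp c"
  have "{l. simplicial_boundary c l \<noteq> 0} \<subseteq> tl ` {l. c l \<noteq> 0}"
  proof safe
    fix l assume "simplicial_boundary c l \<noteq> 0"
    then obtain v where "c (v # l) \<noteq> 0"
      unfolding simplicial_boundary_def by (metis (mono_tags, lifting) mem_Collect_eq sum.neutral)
    then show "l \<in> tl ` {l. c l \<noteq> 0}" by force
  qed
  then show ?thesis using c unfolding finsupp_def by (meson finite_imageI finite_subset)
qed

lemma fin_linear_pairing_boundary: "fin_linear (\<lambda>c. pairing \<phi> (simplicial_boundary c))"
  using fin_linear_pairing[of \<phi>] by (simp add: fin_linear_def boundary_lincomb)

section \<open>Cycles and boundaries as subspaces\<close>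

lemma simplicial_boundaries_0: "0 \<in> simplicial_boundaries K n"
  unfolding simplicial_boundaries_def by (metis boundary_0 image_eqI simplicial_chains_0)

lemma simplicial_boundaries_lincomb:
  assumes "c \<in> simplicial_boundaries K n" "d \<in> simplicial_boundaries K n"
  shows "c + scl a d \<in> simplicial_boundaries K n"
  using assms simplicial_chains_lincomb simplicial_chainsD(1) boundary_lincomb
  unfolding simplicial_boundaries_def by (smt (verit) image_iff)

lemma simplicial_cycles_iff:
  "c \<in> simplicial_cycles K n \<longleftrightarrow> c \<in> simplicial_chains K n \<and> simplicial_boundary c = 0"
  by (simp add: simplicial_cycles_def zero_fun_def)

lemma simplicial_cycles_finsupp: "c \<in> simplicial_cycles K n \<Longrightarrow> finsupp c"
  unfolding simplicial_cycles_iff using simplicial_chainsD(1) by blast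

lemma simplicial_cycles_lincomb:
  "c \<in> simplicial_cycles K n \<Longrightarrow> d \<in> simplicial_cycles K n \<Longrightarrow> c + scl a d \<in> simplicial_cycles K n"
  by (auto simp: simplicial_cycles_iff simplicial_chains_lincomb boundary_lincomb
      simplicial_chainsD(1) fun_eq_iff)

lemma simplicial_cycles_diff:
  "c \<in> simplicial_cycles K n \<Longrightarrow> d \<in> simplicial_cycles K n \<Longrightarrow> c - d \<in> simplicial_cycles K n"
  by (simp add: diff_eq_add_scl simplicial_cycles_lincomb)

lemma simplicial_cycles_0: "0 \<in> simplicial_cycles K n"
  by (simp add: simplicial_cycles_iff simplicial_chains_0)

lemma simplicial_cycles_mono: "K \<subseteq> K' \<Longrightarrow> simplicial_cycles K n \<subseteq> simplicial_cycles K' n"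
  using simplicial_chains_mono unfolding simplicial_cycles_def by blast

section \<open>Barcodes of interval modules\<close>

lemma ex1_uniqueI: "\<exists>!x. P x \<Longrightarrow> P x \<Longrightarrow> P y \<Longrightarrow> x = y"
  by blast

text \<open>One functional \<open>\<phi>\<close> detects the homology at every \<open>t\<close> in
  \<open>J\<close>. As inclusions do not change the pairing, this also makes the maps between the
  one-dimensional homology spaces isomorphisms.\<close>

locale interval_homology =
  fixes n :: nat and K :: "real \<Rightarrow> 'v set set" and J :: "real set" and \<phi> :: "'v list \<Rightarrow> 'k::field"
  assumes mono: "\<And>s t. s \<le> t \<Longrightarrow> K s \<subseteq> K t" and J: "is_interval J"
    and out: "\<And>t z :: 'v list \<Rightarrow> 'k. t \<notin> J \<Longrightarrow> z \<in> simplicial_cycles (K t) n \<Longrightarrow>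
      z \<in> simplicial_boundaries (K t) n"
    and iff: "\<And>t z. t \<in> J \<Longrightarrow> z \<in> simplicial_cycles (K t) n \<Longrightarrow>
      z \<in> simplicial_boundaries (K t) n \<longleftrightarrow> pairing \<phi> z = 0"
    and gen: "\<And>t. t \<in> J \<Longrightarrow> \<exists>z\<in>simplicial_cycles (K t) n. pairing \<phi> z = 1"
begin

text \<open>Generators may be chosen independently at each \<open>t\<close>: two cycles with pairing
  1 differ by a boundary, so the choices are automatically compatible.\<close>

lemma is_barcode: "is_barcode TYPE('k) n K (if J = {} then {#} else {#J#})"
proof (cases "J = {}")
  case True
  have "\<exists>!\<alpha> :: nat \<Rightarrow> 'k. \<forall>i. \<alpha> i = 0"
    by (auto intro!: ex1I[where a = "\<lambda>_. 0"])
  then show ?thesis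
    unfolding is_barcode_def
    using True out by (intro exI[where x = "[]"]) auto
next
  case False
  note lin = fin_linear_pairing[of \<phi>]
  obtain e where e: "\<And>t. t \<in> J \<Longrightarrow> e t \<in> simplicial_cycles (K t) n \<and> pairing \<phi> (e t) = 1"
    using gen by metis
  note fin = simplicial_cycles_finsupp
  have basis: "\<exists>!\<alpha>. (\<forall>i. \<alpha> i \<noteq> 0 \<longrightarrow> i < length [J] \<and> t \<in> [J] ! i) \<and>
      (\<lambda>l. z l - (\<Sum>i | i < length [J] \<and> t \<in> [J] ! i. \<alpha> i * e t l)) \<in> simplicial_boundaries (K t) n"
    if z: "z \<in> simplicial_cycles (K t) n" for z t
  proof (cases "t \<in> J")
    case True
    have eq: "(\<lambda>l. z l - (\<Sum>i | i < length [J] \<and> t \<in> [J] ! i. \<alpha> i * e t l)) = z + scl (- \<alpha> 0) (e t)" for \<alpha>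
    proof -
      have "{i. i < length [J] \<and> t \<in> [J] ! i} = {0}" using True by auto
      then show ?thesis by (simp add: fun_eq_iff)
    qed
    have "z + scl (- a) (e t) \<in> simplicial_boundaries (K t) n \<longleftrightarrow> a = pairing \<phi> z" for a
    proof -
      have et: "e t \<in> simplicial_cycles (K t) n" "pairing \<phi> (e t) = 1" using e True by auto
      have "pairing \<phi> (z + scl (- a) (e t)) = pairing \<phi> z + (- a) * pairing \<phi> (e t)"
        using lin fin[OF z] fin[OF et(1)] unfolding fin_linear_def by blast
      then show ?thesis
        using iff[OF True simplicial_cycles_lincomb[OF z et(1)]] et(2) by auto
    qed
    then show ?thesis
      unfolding eq
    proof (intro ex1I[where a = "\<lambda>i. if i = 0 then pairing \<phi> z else 0"] conjI)
      fix \<alpha>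
      assume a: "\<And>a. (z + scl (- a) (e t) \<in> simplicial_boundaries (K t) n) = (a = pairing \<phi> z)"
        and \<alpha>: "(\<forall>i. \<alpha> i \<noteq> 0 \<longrightarrow> i < length [J] \<and> t \<in> [J] ! i) \<and>
          z + scl (- \<alpha> 0) (e t) \<in> simplicial_boundaries (K t) n"
      have "\<alpha> i = 0" if "i \<noteq> 0" for i using \<alpha> that by auto
      moreover have "\<alpha> 0 = pairing \<phi> z" using \<alpha> a by blast
      ultimately show "\<alpha> = (\<lambda>i. if i = 0 then pairing \<phi> z else 0)" by (simp add: fun_eq_iff)
    qed (use True in \<open>auto split: if_splits\<close>)
  next
    case False
    have "\<exists>!\<alpha> :: nat \<Rightarrow> 'k. \<forall>i. \<alpha> i = 0"
      by (auto intro!: ex1I[where a = "\<lambda>_. 0"])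
    moreover have "(\<forall>i. \<alpha> i \<noteq> 0 \<longrightarrow> i < length [J] \<and> t \<in> [J] ! i) \<longleftrightarrow> (\<forall>i. \<alpha> i = 0)"
      for \<alpha> :: "nat \<Rightarrow> 'k"
      using False by auto
    moreover have "{i. i < length [J] \<and> t \<in> [J] ! i} = {}" using False by auto
    ultimately show ?thesis using out[OF False z] by (simp only: sum.empty diff_zero) simp
  qed
  have compat: "(\<lambda>l. e s l - e t l) \<in> simplicial_boundaries (K t) n"
    if "s \<in> J" "t \<in> J" "s \<le> t" for s t
  proof -
    have s: "e s \<in> simplicial_cycles (K t) n" "pairing \<phi> (e s) = 1"
      using e[OF that(1)] simplicial_cycles_mono[OF mono[OF that(3)]] by auto
    have t: "e t \<in> simplicial_cycles (K t) n" "pairing \<phi> (e t) = 1" using e that by auto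
    have "pairing \<phi> (e s - e t) = 0"
      using fin_linear_diff[OF lin fin[OF s(1)] fin[OF t(1)]] s t by simp
    then have "e s - e t \<in> simplicial_boundaries (K t) n"
      using iff[OF that(2) simplicial_cycles_diff[OF s(1) t(1)]] by simp
    then show ?thesis by (simp add: fun_diff_def)
  qed
  have die: "e s \<in> simplicial_boundaries (K t) n" if "s \<in> J" "t \<notin> J" "s \<le> t" for s t
    using out[OF that(2)] e[OF that(1)] simplicial_cycles_mono[OF mono[OF that(3)]] by blast
  have i: "i = 0" if "i < length [J]" for i using that by simp
  show ?thesis
    unfolding is_barcode_def
  proof (intro exI[where x = "[J]"] exI[where x = "\<lambda>_. e"] conjI allI impI ballI)
    show "mset [J] = (if J = {} then {#} else {#J#})" using False by simp
  qed (erule basis | use False J e compat die in \<open>force dest: i\<close>)+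
qed

text \<open>Since the homology is a line over \<open>J\<close> and zero elsewhere, the bars are
  disjoint and cover \<open>J\<close>. A class cannot die inside \<open>J\<close>, because its
  pairing is nonzero and never changes, so each bar is upward closed in \<open>J\<close>. Nonempty
  disjoint upward closed subsets of a linear order cannot coexist, which leaves at most one
  bar.\<close>

lemma is_barcode_unique:
  assumes B: "is_barcode TYPE('k) n K B"
  shows "B = (if J = {} then {#} else {#J#})"
proof -
  note lin = fin_linear_pairing[of \<phi>]
  obtain Is and e :: "nat \<Rightarrow> real \<Rightarrow> 'v list \<Rightarrow> 'k" where
    Is: "mset Is = B" and ne': "\<forall>i<length Is. is_interval (Is ! i) \<and> Is ! i \<noteq> {}"
    and cyc': "\<forall>i<length Is. \<forall>t\<in>Is ! i. e i t \<in> simplicial_cycles (K t) n"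
    and die': "\<forall>i<length Is. \<forall>s\<in>Is ! i. \<forall>t. t \<notin> Is ! i \<longrightarrow> s \<le> t \<longrightarrow>
       e i s \<in> simplicial_boundaries (K t) n"
    and ex1': "\<forall>t. \<forall>z\<in>simplicial_cycles (K t) n. \<exists>!\<alpha> :: nat \<Rightarrow> 'k.
       (\<forall>i. \<alpha> i \<noteq> 0 \<longrightarrow> i < length Is \<and> t \<in> Is ! i) \<and>
       (\<lambda>l. z l - (\<Sum>i | i < length Is \<and> t \<in> Is ! i. \<alpha> i * e i t l)) \<in> simplicial_boundaries (K t) n"
    using B unfolding is_barcode_def by (elim exE conjE) (rule that; assumption)
  have ne: "Is ! i \<noteq> {}" if "i < length Is" for i
    using ne' that by blast
  have cyc: "e i t \<in> simplicial_cycles (K t) n" if "i < length Is" "t \<in> Is ! i" for i t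
    using cyc' that by blast
  have die: "e i s \<in> simplicial_boundaries (K t) n"
    if "i < length Is" "s \<in> Is ! i" "t \<notin> Is ! i" "s \<le> t" for i s t
    using die' that by blast
  note ex1 = ex1'[rule_format]
  note fin = simplicial_cycles_finsupp
  have bnd: "scl a z \<in> simplicial_boundaries (K t) n"
    if "z \<in> simplicial_boundaries (K t) n" for z :: "'v list \<Rightarrow> 'k" and t a
    using simplicial_boundaries_lincomb[OF simplicial_boundaries_0 that] by simp
  have 0: "\<alpha> = (\<lambda>_. 0)"
    if "\<And>i. \<alpha> i \<noteq> 0 \<Longrightarrow> i < length Is \<and> t \<in> Is ! i"
      and "(\<lambda>l. - (\<Sum>i | i < length Is \<and> t \<in> Is ! i. \<alpha> i * e i t l)) \<in> simplicial_boundaries (K t) n"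
    for \<alpha> t
  proof (rule ex1_uniqueI[OF ex1[OF simplicial_cycles_0]])
    show "(\<forall>i. \<alpha> i \<noteq> 0 \<longrightarrow> i < length Is \<and> t \<in> Is ! i) \<and>
       (\<lambda>l. 0 l - (\<Sum>i | i < length Is \<and> t \<in> Is ! i. \<alpha> i * e i t l)) \<in> simplicial_boundaries (K t) n"
      using that by simp
    show "(\<forall>i. (0 :: 'k) \<noteq> 0 \<longrightarrow> i < length Is \<and> t \<in> Is ! i) \<and>
       (\<lambda>l. 0 l - (\<Sum>i | i < length Is \<and> t \<in> Is ! i. 0 * e i t l)) \<in> simplicial_boundaries (K t) n"
      using simplicial_boundaries_0[of "K t" n] by (simp add: zero_fun_def)
  qed
  \<comment> \<open>If the class were zero, the zero cycle would have two coefficient functions, the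
    indicator of \<open>i\<close> and 0.\<close>
  have nz: "e i t \<notin> simplicial_boundaries (K t) n" if i: "i < length Is" "t \<in> Is ! i" for i t
  proof
    assume e: "e i t \<in> simplicial_boundaries (K t) n"
    have "(\<lambda>l. - (\<Sum>j | j < length Is \<and> t \<in> Is ! j. of_bool (j = i) * e j t l)) = scl (- 1) (e i t)"
      using i by (simp add: fun_eq_iff of_bool_def if_distrib[of "\<lambda>x. x * _"] cong: if_cong)
    then have "(\<lambda>j. of_bool (j = i) :: 'k) = (\<lambda>_. 0)"
      using i bnd[OF e, of "- 1"] by (intro 0[of _ t]) auto
    from fun_cong[OF this, of i] have "of_bool (i = i) = (0 :: 'k)" .
    then show False by simp
  qed
  have sub: "t \<in> J" if "i < length Is" "t \<in> Is ! i" for i t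
    using nz[OF that] cyc[OF that] out by blast
  have \<phi>_nz: "pairing \<phi> (e i t) \<noteq> 0" if "i < length Is" "t \<in> Is ! i" for i t
    using nz[OF that] iff[OF sub[OF that] cyc[OF that]] by simp
  have cover: "\<exists>i<length Is. t \<in> Is ! i" if t: "t \<in> J" for t
  proof (rule ccontr)
    assume "\<not> ?thesis"
    then have no: "{i. i < length Is \<and> t \<in> Is ! i} = {}" by auto
    obtain z where z: "z \<in> simplicial_cycles (K t) n" "pairing \<phi> z = 1" using gen[OF t] by blast
    have "z \<in> simplicial_boundaries (K t) n" using ex1[OF z(1)] unfolding no by auto
    then show False using iff[OF t z(1)] z(2) by simp
  qed
  have uniq: "i = j" if i: "i < length Is" "t \<in> Is ! i" and j: "j < length Is" "t \<in> Is ! j" for i j t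
  proof (rule ccontr)
    assume ij: "i \<noteq> j"
    \<comment> \<open>The linear relation between two vectors of a line: each class is weighted by
      the pairing of the other, with opposite signs, so the combination pairs to 0.\<close>
    define \<alpha> where "\<alpha> k = (if k = i then pairing \<phi> (e j t) else if k = j then - pairing \<phi> (e i t) else 0)" for k
    let ?z = "scl (- pairing \<phi> (e j t)) (e i t) + scl (pairing \<phi> (e i t)) (e j t)"
    have "(\<Sum>k | k < length Is \<and> t \<in> Is ! k. \<alpha> k * e k t l) = (\<Sum>k\<in>{i, j}. \<alpha> k * e k t l)" for l
      by (rule sum.mono_neutral_right) (use i j in \<open>auto simp: \<alpha>_def\<close>)
    then have eq: "(\<lambda>l. - (\<Sum>k | k < length Is \<and> t \<in> Is ! k. \<alpha> k * e k t l)) = ?z"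
      using ij by (simp add: \<alpha>_def fun_eq_iff)
    note c = cyc[OF i] cyc[OF j]
    have z: "?z \<in> simplicial_cycles (K t) n"
      using simplicial_cycles_lincomb[OF simplicial_cycles_lincomb[OF simplicial_cycles_0 c(1)] c(2)]
      by simp
    have eq1: "pairing \<phi> ?z = pairing \<phi> (0 + scl (- pairing \<phi> (e j t)) (e i t)) + pairing \<phi> (e i t) * pairing \<phi> (e j t)"
      using lin fin[OF c(1)] fin[OF c(2)] finsupp_scl unfolding fin_linear_def add_0 by blast
    have eq2: "pairing \<phi> (0 + scl (- pairing \<phi> (e j t)) (e i t)) = pairing \<phi> 0 + (- pairing \<phi> (e j t)) * pairing \<phi> (e i t)"
      using lin fin[OF c(1)] finsupp_0 unfolding fin_linear_def by blast
    have "pairing \<phi> ?z = 0" unfolding eq1 eq2 fin_linear_0[OF lin] by (simp add: mult.commute)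
    then have "?z \<in> simplicial_boundaries (K t) n" by (rule iff[OF sub[OF i] z, THEN iffD2])
    then have "\<alpha> = (\<lambda>_. 0)"
      using i j by (intro 0[of _ t]) (auto simp: \<alpha>_def eq[unfolded \<alpha>_def] split: if_splits)
    then have "\<alpha> i = 0" by simp
    then show False using \<phi>_nz[OF j] by (simp add: \<alpha>_def)
  qed
  have persist: "t \<in> Is ! i" if i: "i < length Is" "s \<in> Is ! i" and t: "s \<le> t" "t \<in> J" for i s t
  proof (rule ccontr)
    assume nt: "t \<notin> Is ! i"
    obtain j where j: "j < length Is" "t \<in> Is ! j" using cover[OF t(2)] by blast
    have "e i s \<in> simplicial_boundaries (K t) n" using die[OF i nt t(1)] .
    then have "pairing \<phi> (e i s) = 0"
      using iff[OF t(2)] cyc[OF i] simplicial_cycles_mono[OF mono[OF t(1)]] by blast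
    then show False using \<phi>_nz[OF i] by simp
  qed
  show ?thesis
  proof (cases "Is = []")
    case True
    then have "J = {}" using cover by auto
    then show ?thesis using True Is by simp
  next
    case False
    then have len: "0 < length Is" by simp
    then obtain s where s: "s \<in> Is ! 0" using ne by blast
    have "t \<in> Is ! 0" if t: "t \<in> J" for t
    proof (cases "s \<le> t")
      case True
      then show ?thesis using persist[OF len s] t by blast
    next
      case False
      obtain j where j: "j < length Is" "t \<in> Is ! j" using cover[OF t] by blast
      then have "s \<in> Is ! j" using persist[OF j] sub[OF len s] False by simp
      then show ?thesis using uniq[OF j(1) _ len s] j by blast
    qed
    then have J0: "Is ! 0 = J" using sub[OF len] by blast
    have "i = 0" if i: "i < length Is" for i
    proof -
      obtain u where u: "u \<in> Is ! i" using ne[OF i] by blast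
      then show ?thesis using uniq[OF i u len] sub[OF i u] J0 by simp
    qed
    then have "\<not> 1 < length Is" by fastforce
    then have "length Is = 1" using len by linarith
    then have "Is = [J]" using J0 by (auto simp: length_Suc_conv)
    moreover have "J \<noteq> {}" using s J0 by blast
    ultimately show ?thesis using Is by auto
  qed
qed

lemma barcode_eq: "barcode TYPE('k) n K = (if J = {} then {#} else {#J#})"
  unfolding barcode_def using is_barcode is_barcode_unique by (rule the_equality)

end

section \<open>Homology of clique complexes in degrees 0 and 1\<close>

text \<open>The relation also encodes the vertex set: \<open>x\<close> is a vertex exactly if
  \<open>A x x\<close>.\<close>

definition clique_complex :: "('v \<Rightarrow> 'v \<Rightarrow> bool) \<Rightarrow> 'v set set" where
  "clique_complex A = {\<sigma>. finite \<sigma> \<and> \<sigma> \<noteq> {} \<and> (\<forall>x\<in>\<sigma>. \<forall>y\<in>\<sigma>. A x y)}"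

lemma clique_complex_mono: "(\<And>x y. A x y \<Longrightarrow> A' x y) \<Longrightarrow> clique_complex A \<subseteq> clique_complex A'"
  unfolding clique_complex_def by blast

lemma boundary_in_boundaries:
  "d \<in> simplicial_chains K (Suc n) \<Longrightarrow> simplicial_boundary d \<in> simplicial_boundaries K n"
  unfolding simplicial_boundaries_def by (rule imageI)

text \<open>Pairing with the constant 1 is the augmentation, to which the two ends of an edge
  contribute opposite amounts.\<close>

lemma boundary_pairing_one_eq_0:
  fixes c :: "'v list \<Rightarrow> 'k::field"
  assumes "c \<in> simplicial_boundaries K 0"
  shows "pairing (\<lambda>_. 1) c = 0"
proof -
  obtain d where d: "d \<in> simplicial_chains K 1" "c = simplicial_boundary d"
    using assms by (auto simp: simplicial_boundaries_def)
  have "pairing (\<lambda>_. 1) (simplicial_boundary d) = (0 :: 'k)"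
  proof (rule simplicial_chains1_eqI[OF d(1) fin_linear_pairing_boundary])
    show "fin_linear (\<lambda>_. 0 :: 'k)" by (simp add: fin_linear_def)
    show "pairing (\<lambda>_. 1) (simplicial_boundary (oedge x y)) = (0 :: 'k)" for x y :: 'v
      by (simp add: boundary_oedge fin_linear_diff[OF fin_linear_pairing])
  qed
  then show ?thesis using d(2) by simp
qed

locale clique =
  fixes A :: "'v \<Rightarrow> 'v \<Rightarrow> bool"
  assumes sym: "A x y \<Longrightarrow> A y x" and vertex: "A x y \<Longrightarrow> A x x"
begin

lemma edge: "{x, y} \<in> clique_complex A \<longleftrightarrow> A x y"
  using sym vertex by (auto simp: clique_complex_def)

lemma triangle: "{x, y, z} \<in> clique_complex A \<longleftrightarrow> A x y \<and> A y z \<and> A x z"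
  using sym vertex by (auto simp: clique_complex_def)

text \<open>Connectedness is phrased through functions that are constant along edges because a
  functional that vanishes on boundaries gives such a function on the vertices. Being constant
  there, it is a multiple of the augmentation.\<close>

lemma boundaries_0_iff:
  fixes c :: "'v list \<Rightarrow> 'k::field"
  assumes conn: "\<And>(f :: 'v \<Rightarrow> 'k) x y. (\<And>x y. A x y \<Longrightarrow> f x = f y) \<Longrightarrow> A x x \<Longrightarrow> A y y \<Longrightarrow> f x = f y"
    and c: "c \<in> simplicial_chains (clique_complex A) 0"
  shows "c \<in> simplicial_boundaries (clique_complex A) 0 \<longleftrightarrow> pairing (\<lambda>_. 1) c = 0"
proof (rule iffI[OF boundary_pairing_one_eq_0], assumption, rule ccontr)
  let ?B = "simplicial_boundaries (clique_complex A) 0 :: ('v list \<Rightarrow> 'k) set"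
  assume c0: "pairing (\<lambda>_. 1) c = 0" and nb: "c \<notin> ?B"
  obtain F :: "('v list \<Rightarrow> 'k) \<Rightarrow> 'k"
    where F: "\<And>c d a. F (c + scl a d) = F c + a * F d" "\<And>c. c \<in> ?B \<Longrightarrow> F c = 0" "F c = 1"
    using separating_functional[OF simplicial_boundaries_0 simplicial_boundaries_lincomb nb] by metis
  have linF: "fin_linear F" using F(1) by (simp add: fin_linear_def)
  have F_edge: "F (single [x]) = F (single [y])" if A: "A x y" for x y
  proof (cases "x = y")
    case False
    have "simplicial_boundary (oedge x y) \<in> ?B"
      using False A edge oedge_in_chains[of x y "clique_complex A"] by (intro boundary_in_boundaries) simp
    then have "F (single [y] - single [x]) = 0" using F(2) by (simp add: boundary_oedge)
    then show ?thesis by (simp add: fin_linear_diff[OF linF])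
  qed simp
  \<comment> \<open>If there is no vertex the choice is arbitrary, but then the comparison on
    vertices below is vacuous.\<close>
  define f0 where "f0 = F (single [SOME x. A x x])"
  have "F c = f0 * pairing (\<lambda>_. 1) c"
  proof (rule simplicial_chains0_eqI[OF c linF])
    show "fin_linear (\<lambda>c. f0 * pairing (\<lambda>_. 1) c)"
      by (intro fin_linear_cmult fin_linear_pairing)
    fix x assume "{x} \<in> clique_complex A"
    then have x: "A x x" using edge[of x x] by simp
    then have "A (SOME x. A x x) (SOME x. A x x)" by (rule someI)
    then have "F (single [x]) = f0"
      unfolding f0_def using conn[of "\<lambda>x. F (single [x])"] F_edge x by blast
    then show "F (single [x]) = f0 * pairing (\<lambda>_. 1) (single [x])" by simp
  qed
  then show False using F(3) c0 by simp
qed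

text \<open>The assumption on \<open>\<phi>\<close> is the cocycle identity for its
  antisymmetrisation, so the pairing vanishes on the boundary of every triangle.\<close>

lemma boundary_pairing_eq_0:
  fixes c :: "'v list \<Rightarrow> 'k::field"
  assumes \<phi>: "\<And>x y z. A x y \<Longrightarrow> A y z \<Longrightarrow> A x z \<Longrightarrow>
      (\<phi> [x, y] - \<phi> [y, x]) + (\<phi> [y, z] - \<phi> [z, y]) = \<phi> [x, z] - \<phi> [z, x]"
    and c: "c \<in> simplicial_boundaries (clique_complex A) 1"
  shows "pairing \<phi> c = 0"
proof -
  note lin = fin_linear_pairing[of \<phi>]
  obtain d where d: "d \<in> simplicial_chains (clique_complex A) 2" "c = simplicial_boundary d"
    using c by (auto simp: simplicial_boundaries_def numeral_2_eq_2)
  have oe: "pairing \<phi> (oedge x y) = \<phi> [x, y] - \<phi> [y, x]" for x y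
    by (simp add: oedge_def fin_linear_diff[OF lin])
  have "pairing \<phi> (simplicial_boundary d) = 0"
  proof (rule simplicial_chains2_eqI[OF d(1) fin_linear_pairing_boundary])
    show "fin_linear (\<lambda>_. 0 :: 'k)" by (simp add: fin_linear_def)
    fix x y z assume "{x, y, z} \<in> clique_complex A"
    then have "A x y" "A y z" "A x z" by (auto simp: triangle)
    from \<phi>[OF this] show "pairing \<phi> (simplicial_boundary (otriangle x y z)) = 0"
      by (simp add: boundary_otriangle fin_linear_add[OF lin] oe algebra_simps)
  qed
  then show ?thesis using d(2) by simp
qed

text \<open>By duality over the field, a cycle is a boundary as soon as every 1-cocycle \<open>g\<close>
  vanishes on it; the hypothesis says that \<open>\<phi>\<close> spans the first cohomology.\<close>

lemma cycle_imp_boundary_1: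
  fixes c :: "'v list \<Rightarrow> 'k::field"
  assumes coh: "\<And>g :: 'v \<Rightarrow> 'v \<Rightarrow> 'k. (\<And>x y z. A x y \<Longrightarrow> A y z \<Longrightarrow> A x z \<Longrightarrow> g x y + g y z = g x z) \<Longrightarrow>
      \<exists>a h. \<forall>x y. A x y \<longrightarrow> g x y = a * (\<phi> [x, y] - \<phi> [y, x]) + (h y - h x)"
    and c: "c \<in> simplicial_cycles (clique_complex A) 1" and c0: "pairing \<phi> c = 0"
  shows "c \<in> simplicial_boundaries (clique_complex A) 1"
proof (rule ccontr)
  let ?B = "simplicial_boundaries (clique_complex A) 1 :: ('v list \<Rightarrow> 'k) set"
  assume nb: "c \<notin> ?B"
  obtain F :: "('v list \<Rightarrow> 'k) \<Rightarrow> 'k"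
    where F: "\<And>c d a. F (c + scl a d) = F c + a * F d" "\<And>c. c \<in> ?B \<Longrightarrow> F c = 0" "F c = 1"
    using separating_functional[OF simplicial_boundaries_0 simplicial_boundaries_lincomb nb] by metis
  have linF: "fin_linear F" using F(1) by (simp add: fin_linear_def)
  have F_swap: "F (oedge y x) = - F (oedge x y)" for x y
  proof -
    have "F (0 - oedge x y) = F 0 - F (oedge x y)"
      by (rule fin_linear_diff[OF linF]) simp_all
    then show ?thesis by (simp add: oedge_swap[of y x] fin_linear_0[OF linF])
  qed
  have "F (oedge x y) + F (oedge y z) = F (oedge x z)" if A: "A x y" "A y z" "A x z" for x y z
  proof (cases "distinct [x, y, z]")
    case True
    have "simplicial_boundary (otriangle x y z) \<in> ?B"
      using otriangle_in_chains[OF True, of "clique_complex A"] A triangle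
      by (intro boundary_in_boundaries) (simp add: numeral_2_eq_2)
    then have "F (oedge y z + oedge z x + oedge x y) = 0" using F(2) by (simp add: boundary_otriangle)
    then have "F (oedge x y) + F (oedge y z) - F (oedge x z) = 0"
      using F_swap[of x z] by (simp add: fin_linear_add[OF linF] algebra_simps)
    then show ?thesis by simp
  next
    case False
    \<comment> \<open>If \<open>x = z\<close>, the two edges on the left cancel. Otherwise one of
      them is degenerate, hence 0, and the other is the edge on the right.\<close>
    then show ?thesis using F_swap[of x y] fin_linear_0[OF linF] by auto
  qed
  then obtain a h where ah: "\<And>x y. A x y \<Longrightarrow> F (oedge x y) = a * (\<phi> [x, y] - \<phi> [y, x]) + (h y - h x)"
    using coh[of "\<lambda>x y. F (oedge x y)"] by metis
  have chain: "c \<in> simplicial_chains (clique_complex A) 1" and cyc: "simplicial_boundary c = 0"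
    using c by (auto simp: simplicial_cycles_iff)
  \<comment> \<open>The coboundary part of \<open>F\<close> is the pairing of \<open>h\<close> with
    the boundary, so it vanishes on cycles. Lists in a 0-chain have one entry, which
    \<open>hd\<close> reads off.\<close>
  have "F c = a * pairing \<phi> c + pairing (\<lambda>l. h (hd l)) (simplicial_boundary c)"
  proof (rule simplicial_chains1_eqI[OF chain linF])
    show "fin_linear (\<lambda>c. a * pairing \<phi> c + pairing (\<lambda>l. h (hd l)) (simplicial_boundary c))"
      by (intro fin_linear_plus fin_linear_cmult fin_linear_pairing fin_linear_pairing_boundary)
    fix x y assume "{x, y} \<in> clique_complex A"
    then show "F (oedge x y) = a * pairing \<phi> (oedge x y) + pairing (\<lambda>l. h (hd l)) (simplicial_boundary (oedge x y))"
      unfolding boundary_oedge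
      by (simp add: oedge_def[of x y] fin_linear_diff[OF fin_linear_pairing])
         (simp add: oedge_def[symmetric] ah edge)
  qed
  then have "F c = 0" by (simp add: c0 cyc fin_linear_0[OF fin_linear_pairing])
  then show False using F(3) by simp
qed

end

section \<open>Cocycles on Euclidean space\<close>

lemma sum_lessThan_double:
  "(\<Sum>j<2 * m. f j) = (\<Sum>j<m. f (2 * j) + f (2 * j + 1 :: nat) :: 'b::comm_monoid_add)"
  by (induction m) (simp_all add: algebra_simps)

text \<open>\<open>S\<close> models the displacements upstairs that project to edges. Openness is
  stated as room to enlarge all coordinates at once by a dyadic fraction of a given vector, the only
  form in which it is applied.\<close>

locale solid_open =
  fixes S :: "('i \<Rightarrow> real) set"
  assumes solid: "d \<in> S \<Longrightarrow> (\<And>i. \<bar>d' i\<bar> \<le> \<bar>d i\<bar>) \<Longrightarrow> d' \<in> S"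
    and open_at: "d \<in> S \<Longrightarrow> \<forall>\<^sub>F n in sequentially. (\<lambda>i. \<bar>d i\<bar> + \<bar>u i\<bar> / 2 ^ n) \<in> S"
    and zero: "0 \<in> S"
begin

lemma eventually_small: "\<forall>\<^sub>F n in sequentially. scl (1 / 2 ^ n) u \<in> S"
  using open_at[OF zero, of u]
  by eventually_elim (erule solid, simp add: abs_mult)

text \<open>The segment from \<open>u\<close> to \<open>v\<close>, cut into sufficiently many equal
  pieces, is a path with steps in \<open>S\<close>.\<close>

lemma locally_constant_imp_constant:
  assumes f: "\<And>u v. v - u \<in> S \<Longrightarrow> f u = f v"
  shows "f u = f v"
proof -
  obtain n where n: "scl (1 / 2 ^ n) (v - u) \<in> S"
    using eventually_happens[OF eventually_small] by auto
  have "f u = f (u + scl (real j / 2 ^ n) (v - u))" for j :: nat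
  proof (induction j)
    case 0
    have "u + scl 0 (v - u) = u" by (simp add: fun_eq_iff)
    then show ?case by simp
  next
    case (Suc j)
    have "(u + scl (real (Suc j) / 2 ^ n) (v - u)) - (u + scl (real j / 2 ^ n) (v - u)) = scl (1 / 2 ^ n) (v - u)"
      by (simp add: fun_eq_iff field_simps)
    then show ?case using Suc f n by metis
  qed
  from this[of "2 ^ n"] show ?thesis by (simp add: scl_def fun_eq_iff plus_fun_def)
qed

definition ray_sum :: "(('i \<Rightarrow> real) \<Rightarrow> ('i \<Rightarrow> real) \<Rightarrow> 'b::ab_group_add) \<Rightarrow> nat \<Rightarrow> ('i \<Rightarrow> real) \<Rightarrow> 'b" where
  "ray_sum G n u = (\<Sum>j<2 ^ n. G (scl (real j / 2 ^ n) u) (scl (real (Suc j) / 2 ^ n) u))"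

text \<open>The potential at \<open>u\<close> is the sum of \<open>G\<close> along the segment from 0 to \<open>u\<close>, cut into
  \<open>2\<^sup>n\<close> equal pieces; this does not depend on \<open>n\<close> once the pieces are small.\<close>

lemma cocycle_potential:
  fixes G :: "('i \<Rightarrow> real) \<Rightarrow> ('i \<Rightarrow> real) \<Rightarrow> 'b::ab_group_add"
  assumes G: "\<And>u v w. v - u \<in> S \<Longrightarrow> w - v \<in> S \<Longrightarrow> w - u \<in> S \<Longrightarrow> G u v + G v w = G u w"
  obtains H where "\<And>u v. v - u \<in> S \<Longrightarrow> G u v = H v - H u"
proof -
  have refine: "ray_sum G (Suc n) u = ray_sum G n u" if n: "scl (1 / 2 ^ n) u \<in> S" for n u
  proof -
    have n': "scl (1 / 2 ^ Suc n) u \<in> S"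
      by (rule solid[OF n]) (simp add: abs_mult field_simps)
    have "G (scl (real (2 * j) / 2 ^ Suc n) u) (scl (real (Suc (2 * j)) / 2 ^ Suc n) u)
        + G (scl (real (2 * j + 1) / 2 ^ Suc n) u) (scl (real (Suc (2 * j + 1)) / 2 ^ Suc n) u)
        = G (scl (real j / 2 ^ n) u) (scl (real (Suc j) / 2 ^ n) u)" for j
    proof -
      let ?a = "scl (real (2 * j) / 2 ^ Suc n) u" and ?b = "scl (real (2 * j + 1) / 2 ^ Suc n) u"
        and ?c = "scl (real (Suc (2 * j + 1)) / 2 ^ Suc n) u"
      have "?b - ?a = scl (1 / 2 ^ Suc n) u" "?c - ?b = scl (1 / 2 ^ Suc n) u" "?c - ?a = scl (1 / 2 ^ n) u"
        by (simp_all add: fun_eq_iff field_simps)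
      then have "G ?a ?b + G ?b ?c = G ?a ?c" using n n' by (intro G) simp_all
      moreover have "real (2 * j) / 2 ^ Suc n = real j / 2 ^ n"
          "real (Suc (2 * j + 1)) / 2 ^ Suc n = real (Suc j) / 2 ^ n"
        by (simp_all add: field_simps)
      ultimately show ?thesis by (simp only: Suc_eq_plus1)
    qed
    then show ?thesis
      unfolding ray_sum_def power_Suc[of _ n] sum_lessThan_double by (simp del: power_Suc)
  qed
  have "\<exists>a. \<forall>\<^sub>F n in sequentially. ray_sum G n u = a" for u
  proof -
    obtain n0 where n0: "\<And>n. n \<ge> n0 \<Longrightarrow> scl (1 / 2 ^ n) u \<in> S"
      using eventually_small[of u] unfolding eventually_sequentially by blast
    have "ray_sum G n u = ray_sum G n0 u" if "n \<ge> n0" for n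
      using that by (induction n rule: nat_induct_at_least) (simp_all add: refine n0)
    then show ?thesis unfolding eventually_sequentially by blast
  qed
  then obtain H where H: "\<And>u. \<forall>\<^sub>F n in sequentially. ray_sum G n u = H u" by metis
  show thesis
  proof
    fix u v assume d: "v - u \<in> S"
    \<comment> \<open>The displacement \<open>v - u\<close>, enlarged by one piece of each of the
      two segments from 0, must still be allowed. Then all sides and diagonals of the thin strip
      between these segments are allowed. The outer absolute value only matches the shape of
      \<open>open_at\<close>.\<close>
    have "\<forall>\<^sub>F n in sequentially. ray_sum G n u = H u \<and> ray_sum G n v = H v \<and>
        (\<lambda>i. \<bar>(v - u) i\<bar> + \<bar>\<bar>u i\<bar> + \<bar>v i\<bar>\<bar> / 2 ^ n) \<in> S"
      by (intro eventually_conj H open_at[OF d])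
    then obtain n where n: "ray_sum G n u = H u" "ray_sum G n v = H v"
        "(\<lambda>i. \<bar>(v - u) i\<bar> + \<bar>\<bar>u i\<bar> + \<bar>v i\<bar>\<bar> / 2 ^ n) \<in> S" (is "?e \<in> S")
      using eventually_happens by force
    define a b where "a j = scl (real j / 2 ^ n) u" and "b j = scl (real j / 2 ^ n) v" for j
    \<comment> \<open>A quadrilateral of the strip is cut by the diagonal from \<open>a j\<close> to
      \<open>b (Suc j)\<close>. The cocycle identity on its two triangles compares opposite sides,
      and the sum over \<open>j\<close> telescopes to the far side, since the near side shrinks to
      the point 0.\<close>
    have "G (b j) (b (Suc j)) - G (a j) (a (Suc j)) = G (a (Suc j)) (b (Suc j)) - G (a j) (b j)"
      if j: "j < 2 ^ n" for j
    proof -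
      have *: "real k / 2 ^ n * x \<le> x" if "k \<le> 2 ^ n" "x \<ge> 0" for k x
      proof -
        have "real k \<le> 2 ^ n" using that(1) by (metis of_nat_le_iff of_nat_numeral of_nat_power)
        then show ?thesis using that(2) by (intro mult_left_le_one_le) auto
      qed
      have e: "\<bar>?e i\<bar> = \<bar>v i - u i\<bar> + \<bar>u i\<bar> / 2 ^ n + \<bar>v i\<bar> / 2 ^ n" for i
        by (simp add: add_divide_distrib)
      have nonneg: "0 \<le> \<bar>x\<bar> / 2 ^ n" for x :: real by simp
      have ba: "b k - a k \<in> S" if "k \<le> 2 ^ n" for k
      proof (rule solid[OF n(3)])
        fix i
        have "(b k - a k) i = real k / 2 ^ n * (v i - u i)"
          by (simp add: a_def b_def right_diff_distrib)
        then have "\<bar>(b k - a k) i\<bar> = real k / 2 ^ n * \<bar>v i - u i\<bar>" by (simp add: abs_mult)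
        also have "\<dots> \<le> \<bar>v i - u i\<bar>" using that by (intro *) auto
        finally show "\<bar>(b k - a k) i\<bar> \<le> \<bar>?e i\<bar>"
          unfolding e using nonneg[of "u i"] nonneg[of "v i"] by linarith
      qed
      have aa: "a (Suc j) - a j \<in> S" and bb: "b (Suc j) - b j \<in> S"
        by (rule solid[OF n(3)], unfold e, simp add: a_def b_def field_simps abs_mult)+
      have ab: "b (Suc j) - a j \<in> S"
      proof (rule solid[OF n(3)])
        fix i
        have "(b (Suc j) - a j) i = real j / 2 ^ n * (v i - u i) + v i / 2 ^ n"
          by (simp add: a_def b_def field_simps)
        then have "\<bar>(b (Suc j) - a j) i\<bar> \<le> \<bar>real j / 2 ^ n * (v i - u i)\<bar> + \<bar>v i / 2 ^ n\<bar>"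
          by (simp only: abs_triangle_ineq)
        also have "\<dots> = real j / 2 ^ n * \<bar>v i - u i\<bar> + \<bar>v i\<bar> / 2 ^ n"
          by (simp add: abs_mult)
        finally have "\<bar>(b (Suc j) - a j) i\<bar> \<le> real j / 2 ^ n * \<bar>v i - u i\<bar> + \<bar>v i\<bar> / 2 ^ n" .
        moreover have "real j / 2 ^ n * \<bar>v i - u i\<bar> \<le> \<bar>v i - u i\<bar>" using j by (intro *) auto
        ultimately show "\<bar>(b (Suc j) - a j) i\<bar> \<le> \<bar>?e i\<bar>" unfolding e using nonneg[of "u i"] by linarith
      qed
      have "G (a j) (a (Suc j)) + G (a (Suc j)) (b (Suc j)) = G (a j) (b (Suc j))"
        using G[OF aa ba ab] j by simp
      moreover have "G (a j) (b j) + G (b j) (b (Suc j)) = G (a j) (b (Suc j))"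
        using G[OF ba bb ab] j by simp
      ultimately show ?thesis by (simp add: algebra_simps)
    qed
    moreover have "ray_sum G n v = (\<Sum>j<2 ^ n. G (b j) (b (Suc j)))"
        "ray_sum G n u = (\<Sum>j<2 ^ n. G (a j) (a (Suc j)))"
      by (simp_all only: ray_sum_def a_def b_def)
    ultimately have "ray_sum G n v - ray_sum G n u = (\<Sum>j<2 ^ n. G (a (Suc j)) (b (Suc j)) - G (a j) (b j))"
      by (simp add: sum_subtractf[symmetric])
    also have "\<dots> = G (a (2 ^ n)) (b (2 ^ n)) - G (a 0) (b 0)"
      by (rule sum_lessThan_telescope)
    finally have "ray_sum G n v - ray_sum G n u = G (a (2 ^ n)) (b (2 ^ n)) - G (a 0) (b 0)" .
    moreover have "a (2 ^ n) = u" "b (2 ^ n) = v" "a 0 = 0" "b 0 = 0"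
      by (simp_all add: a_def b_def fun_eq_iff)
    moreover have "G 0 0 = 0" using G[of 0 0 0] zero by simp
    ultimately show "G u v = H v - H u" using n by simp
  qed
qed

text \<open>Invariance of \<open>G\<close> under the shift by \<open>p\<close> makes
  \<open>H (u + p) - H u\<close> locally constant in \<open>u\<close>. A period thus does not depend
  on the starting point, which makes periods additive.\<close>

lemma period_constant:
  fixes H :: "('i \<Rightarrow> real) \<Rightarrow> 'b::ab_group_add"
  assumes H: "\<And>u v. v - u \<in> S \<Longrightarrow> G u v = H v - H u"
    and per: "\<And>u v. G (u + p) (v + p) = G u v"
  shows "H (u + p) - H u = H p - H 0"
proof -
  have "H (u + p) - H u = H (0 + p) - H 0"
  proof (rule locally_constant_imp_constant[where f = "\<lambda>u. H (u + p) - H u"])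
    fix u v assume d: "v - u \<in> S"
    moreover have "(v + p) - (u + p) \<in> S" using d by simp
    ultimately have "H (v + p) - H (u + p) = H v - H u" using H per by metis
    then show "H (u + p) - H u = H (v + p) - H v" by (simp add: algebra_simps)
  qed
  then show ?thesis by simp
qed

end

section \<open>Cocycles on the torus\<close>

definition circ :: "real \<Rightarrow> real \<Rightarrow> real \<times> real" where
  "circ r s = (r * cos s, r * sin s)"

definition angle :: "real \<times> real \<Rightarrow> real" where
  "angle p = Arg2pi (Complex (fst p) (snd p))"

text \<open>The length of the chord that subtends the angle \<open>d\<close>, frozen at the diameter
  beyond half a turn. Unlike the periodic distance on the circle it is monotone in the absolute
  value of \<open>d\<close>, which makes the set of allowed displacements
  \<open>solid\<close>.\<close>

definition chord :: "real \<Rightarrow> real \<Rightarrow> real" where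
  "chord r d = 2 * r * sin (min \<bar>d\<bar> pi / 2)"

lemma circ_periodic:
  assumes "k \<in> {-1, 0, 1 :: real}" shows "circ r (s + 2 * pi * k) = circ r s"
  using assms by (auto simp: circ_def cos_diff sin_diff)

lemma norm_circ: "r \<ge> 0 \<Longrightarrow> norm (circ r s) = r"
proof -
  assume r: "r \<ge> 0"
  have "(r * cos s)\<^sup>2 + (r * sin s)\<^sup>2 = r\<^sup>2 * ((cos s)\<^sup>2 + (sin s)\<^sup>2)"
    by (simp only: power_mult_distrib distrib_left)
  also have "\<dots> = r\<^sup>2" by (simp only: sin_cos_squared_add2 mult_1_right)
  finally have "(r * cos s)\<^sup>2 + (r * sin s)\<^sup>2 = r\<^sup>2" .
  then show ?thesis using r by (simp add: circ_def norm_Pair)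
qed

lemma circ_angle: "circ (norm p) (angle p) = p"
proof -
  have "Complex (fst p) (snd p) = complex_of_real (norm p) * exp (\<i> * complex_of_real (angle p))"
    using Arg2pi_eq[of "Complex (fst p) (snd p)"] by (simp add: angle_def norm_prod_def complex_norm)
  then have "fst p = Re (complex_of_real (norm p) * exp (\<i> * complex_of_real (angle p)))"
      "snd p = Im (complex_of_real (norm p) * exp (\<i> * complex_of_real (angle p)))"
    by (metis complex.sel(1), metis complex.sel(2))
  then show ?thesis by (simp add: circ_def prod_eq_iff Re_exp Im_exp)
qed

lemma angle_bounds: "0 \<le> angle p" "angle p < 2 * pi"
  by (simp_all add: angle_def Arg2pi_ge_0 Arg2pi_lt_2pi)

lemma angle_circ: "r > 0 \<Longrightarrow> 0 \<le> s \<Longrightarrow> s < 2 * pi \<Longrightarrow> angle (circ r s) = s"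
  unfolding angle_def
  by (rule Arg2pi_unique[of r]) (simp_all add: circ_def complex_eq_iff Re_exp Im_exp)

lemma dist_circ: "r \<ge> 0 \<Longrightarrow> dist (circ r s) (circ r t) = 2 * r * \<bar>sin ((t - s) / 2)\<bar>"
proof -
  assume r: "r \<ge> 0"
  have "2 * ((t - s) / 2) = t - s" by simp
  then have "cos (t - s) = 1 - 2 * (sin ((t - s) / 2))\<^sup>2"
    using cos_double_sin[of "(t - s) / 2"] by (simp only:)
  then have c: "cos t * cos s + sin t * sin s = 1 - 2 * (sin ((t - s) / 2))\<^sup>2" by (simp add: cos_diff)
  have "(r * cos s - r * cos t)\<^sup>2 + (r * sin s - r * sin t)\<^sup>2
      = r\<^sup>2 * (((sin s)\<^sup>2 + (cos s)\<^sup>2) + ((sin t)\<^sup>2 + (cos t)\<^sup>2) - 2 * (cos t * cos s + sin t * sin s))"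
    by algebra
  also have "\<dots> = (2 * r * sin ((t - s) / 2))\<^sup>2"
    unfolding c sin_cos_squared_add by (simp add: power_mult_distrib algebra_simps)
  finally have "dist (circ r s) (circ r t) = sqrt ((2 * r * sin ((t - s) / 2))\<^sup>2)"
    by (simp add: circ_def dist_Pair_Pair dist_real_def)
  then show ?thesis using r by (simp add: abs_mult)
qed

lemma chord_0 [simp]: "chord r 0 = 0"
  by (simp add: chord_def)

lemma chord_mono:
  assumes "r \<ge> 0" "\<bar>d'\<bar> \<le> \<bar>d\<bar>" shows "chord r d' \<le> chord r d"
proof -
  have "sin (min \<bar>d'\<bar> pi / 2) \<le> sin (min \<bar>d\<bar> pi / 2)"
    using assms(2) pi_gt_zero abs_ge_zero[of d'] by (intro sin_monotone_2pi_le) linarith+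
  then show ?thesis using assms(1) by (simp add: chord_def mult_left_mono)
qed

lemma abs_sin_half: "\<bar>d\<bar> \<le> pi \<Longrightarrow> \<bar>sin (d / 2)\<bar> = sin (min \<bar>d\<bar> pi / 2)"
proof -
  assume d: "\<bar>d\<bar> \<le> pi"
  then have "sin (\<bar>d\<bar> / 2) \<ge> 0" by (intro sin_ge_zero) auto
  moreover have "\<bar>sin (d / 2)\<bar> = \<bar>sin (\<bar>d\<bar> / 2)\<bar>" by (cases "d \<ge> 0") auto
  ultimately show ?thesis using d by (simp add: min_def)
qed

lemma dist_circ_le_chord: "r \<ge> 0 \<Longrightarrow> dist (circ r s) (circ r t) \<le> chord r (t - s)"
proof -
  assume r: "r \<ge> 0"
  have "\<bar>sin ((t - s) / 2)\<bar> \<le> sin (min \<bar>t - s\<bar> pi / 2)"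
    using abs_sin_half[of "t - s"] by (cases "\<bar>t - s\<bar> \<le> pi") (auto simp: min_def)
  then show ?thesis using r by (simp add: dist_circ chord_def mult_left_mono)
qed

lemma dist_circ_eq_chord: "r \<ge> 0 \<Longrightarrow> \<bar>t - s\<bar> \<le> pi \<Longrightarrow> dist (circ r s) (circ r t) = chord r (t - s)"
  by (simp add: dist_circ chord_def abs_sin_half)

text \<open>A third of a turn spans the side of an inscribed equilateral triangle; the death times
  get their constant here.\<close>

lemma chord_third: "chord r (2 * pi / 3) = sqrt 3 * r"
proof -
  have "min \<bar>2 * pi / 3\<bar> pi / 2 = pi / 3" using pi_gt_zero by (simp add: min_def)
  then show ?thesis by (simp add: chord_def sin_60)
qed

text \<open>The number of full turns to add to the angle of \<open>q\<close> so that it comes within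
  half a turn of the angle of \<open>p\<close>.\<close>

definition wind :: "real \<times> real \<Rightarrow> real \<times> real \<Rightarrow> real" where
  "wind p q = of_bool (angle p - angle q > pi) - of_bool (angle q - angle p > pi)"

lemma wind_lift: "\<bar>angle q + 2 * pi * wind p q - angle p\<bar> \<le> pi"
  using angle_bounds[of p] angle_bounds[of q] by (auto simp: wind_def)

lemma wind_cases: "wind p q \<in> {-1, 0, 1}"
  by (auto simp: wind_def)

text \<open>On a triangle whose sides are shorter than those of an inscribed equilateral triangle,
  the three signed angles are smaller than a third of a turn, so they add up to 0.\<close>

lemma wind_triangle:
  assumes r: "r > 0" and p: "norm p = r" and q: "norm q = r" and s: "norm s = r"
    and pq: "dist p q < sqrt 3 * r" and qs: "dist q s < sqrt 3 * r" and ps: "dist p s < sqrt 3 * r"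
  shows "wind p q + wind q s = wind p s"
proof -
  have short: "\<bar>angle v + 2 * pi * wind u v - angle u\<bar> < 2 * pi / 3"
    if "norm u = r" "norm v = r" "dist u v < sqrt 3 * r" for u v
  proof (rule ccontr)
    let ?d = "angle v + 2 * pi * wind u v - angle u"
    assume "\<not> \<bar>?d\<bar> < 2 * pi / 3"
    then have "chord r (2 * pi / 3) \<le> chord r ?d" using r by (intro chord_mono) auto
    also have "\<dots> = dist (circ r (angle u)) (circ r (angle v + 2 * pi * wind u v))"
      using r wind_lift by (intro dist_circ_eq_chord[symmetric]) auto
    also have "\<dots> = dist u v"
      using that circ_angle[of u] circ_angle[of v] by (simp only: circ_periodic[OF wind_cases])
    finally show False using that by (simp add: chord_third)
  qed
  \<comment> \<open>In the signed sum of the three lifted angle differences the angles themselves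
    cancel. What remains is \<open>?W\<close> full turns, less than one in absolute value, and
    \<open>?W\<close> is an integer.\<close>
  let ?W = "wind p q + wind q s - wind p s"
  have "?W * (2 * pi) = 2 * pi * wind p q + 2 * pi * wind q s - 2 * pi * wind p s"
    by (simp add: algebra_simps)
  then have "\<bar>?W * (2 * pi)\<bar> < 2 * pi"
    using short[OF p q pq] short[OF q s qs] short[OF p s ps] unfolding abs_less_iff by linarith
  then have "\<bar>?W\<bar> * (2 * pi) < 1 * (2 * pi)" by (simp add: abs_mult)
  then have "\<bar>wind p q + wind q s - wind p s\<bar> < 1" by (rule mult_right_less_imp_less) simp
  then show ?thesis using wind_cases[of p q] wind_cases[of q s] wind_cases[of p s] by auto
qed

section \<open>Lifting edges and cocycles from the torus to Euclidean space\<close>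

text \<open>A radius may be 0, as a Fourier coefficient may vanish; that circle is then a
  point.\<close>

locale torus =
  fixes I :: "'i set" and r :: "'i \<Rightarrow> real"
  assumes finite_I: "finite I" and r: "\<And>i. i \<in> I \<Longrightarrow> r i \<ge> 0"
begin

definition adj :: "('i \<Rightarrow> real) \<Rightarrow> ('i \<Rightarrow> real \<times> real) \<Rightarrow> ('i \<Rightarrow> real \<times> real) \<Rightarrow> bool" where
  "adj \<epsilon> x y \<longleftrightarrow> x \<in> (\<Pi>\<^sub>E i\<in>I. sphere 0 (r i)) \<and> y \<in> (\<Pi>\<^sub>E i\<in>I. sphere 0 (r i)) \<and>
     (\<forall>i\<in>I. dist (x i) (y i) < \<epsilon> i)"

lemma clique_adj: "clique (adj \<epsilon>)"
proof
  fix x y assume xy: "adj \<epsilon> x y"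
  then show "adj \<epsilon> y x" by (simp add: adj_def dist_commute)
  show "adj \<epsilon> x x" using xy unfolding adj_def by (metis dist_self le_less_trans zero_le_dist)
qed

lemma adj_mono: "adj \<epsilon> x y \<Longrightarrow> (\<And>i. i \<in> I \<Longrightarrow> \<epsilon> i \<le> \<epsilon>' i) \<Longrightarrow> adj \<epsilon>' x y"
  unfolding adj_def by (meson less_le_trans)

definition point :: "('i \<Rightarrow> real) \<Rightarrow> 'i \<Rightarrow> real \<times> real" where
  "point u = (\<lambda>i\<in>I. circ (r i) (u i))"

lemma point_in_torus: "point u \<in> (\<Pi>\<^sub>E i\<in>I. sphere 0 (r i))"
  using r norm_circ by (auto simp: point_def)

lemma point_angle:
  assumes "x \<in> (\<Pi>\<^sub>E i\<in>I. sphere 0 (r i))" shows "point (\<lambda>i. angle (x i)) = x"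
proof
  fix i
  show "point (\<lambda>i. angle (x i)) i = x i"
  proof (cases "i \<in> I")
    case True
    then have "r i = norm (x i)" using PiE_mem[OF assms True] by simp
    then show ?thesis using True by (simp add: point_def circ_angle)
  next
    case False
    then show ?thesis using PiE_arb[OF assms False] by (simp add: point_def)
  qed
qed

text \<open>These displacements project to edges from every starting point. Conversely every edge
  lifts to one of them, after full turns are added so that each coordinate moves by at most half a
  turn.\<close>

definition steps :: "('i \<Rightarrow> real) \<Rightarrow> ('i \<Rightarrow> real) set" where
  "steps \<epsilon> = {d. \<forall>i\<in>I. chord (r i) (d i) < \<epsilon> i}"

lemma adj_point: "v - u \<in> steps \<epsilon> \<Longrightarrow> adj \<epsilon> (point u) (point v)"
  using point_in_torus[of u] point_in_torus[of v] le_less_trans[OF dist_circ_le_chord[OF r]]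
  unfolding adj_def steps_def by (simp add: point_def)

text \<open>In each coordinate the room to enlarge comes from continuity of \<open>chord\<close>;
  finiteness of \<open>I\<close> combines the conditions.\<close>

lemma solid_open_steps:
  assumes \<epsilon>: "\<And>i. i \<in> I \<Longrightarrow> \<epsilon> i > 0" shows "solid_open (steps \<epsilon>)"
proof
  show "0 \<in> steps \<epsilon>" using \<epsilon> by (simp add: steps_def)
  show "d' \<in> steps \<epsilon>" if "d \<in> steps \<epsilon>" "\<And>i. \<bar>d' i\<bar> \<le> \<bar>d i\<bar>" for d d'
    using that(1) le_less_trans[OF chord_mono[OF r that(2)]] by (auto simp: steps_def)
  fix d u :: "'i \<Rightarrow> real" assume d: "d \<in> steps \<epsilon>"
  have "\<forall>\<^sub>F n in sequentially. chord (r i) (\<bar>d i\<bar> + \<bar>u i\<bar> / 2 ^ n) < \<epsilon> i" if i: "i \<in> I" for i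
  proof (rule order_tendstoD(2))
    have "(\<lambda>n. (1 / 2 :: real) ^ n) \<longlonglongrightarrow> 0" by (rule LIMSEQ_realpow_zero) auto
    then have "(\<lambda>n. \<bar>u i\<bar> * (1 / 2) ^ n) \<longlonglongrightarrow> \<bar>u i\<bar> * 0" by (rule tendsto_mult[OF tendsto_const])
    then have "(\<lambda>n. \<bar>u i\<bar> / 2 ^ n) \<longlonglongrightarrow> 0" by (simp add: power_divide)
    then have "(\<lambda>n. chord (r i) (\<bar>d i\<bar> + \<bar>u i\<bar> / 2 ^ n)) \<longlonglongrightarrow> chord (r i) (\<bar>d i\<bar> + 0)"
      unfolding chord_def by (intro tendsto_intros) simp_all
    then show "(\<lambda>n. chord (r i) (\<bar>d i\<bar> + \<bar>u i\<bar> / 2 ^ n)) \<longlonglongrightarrow> chord (r i) (d i)"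
      by (simp add: chord_def)
    show "chord (r i) (d i) < \<epsilon> i" using d i by (simp add: steps_def)
  qed
  then show "\<forall>\<^sub>F n in sequentially. (\<lambda>i. \<bar>d i\<bar> + \<bar>u i\<bar> / 2 ^ n) \<in> steps \<epsilon>"
    unfolding steps_def using finite_I by (simp add: eventually_ball_finite)
qed

lemma adj_connected:
  assumes \<epsilon>: "\<And>i. i \<in> I \<Longrightarrow> \<epsilon> i > 0" and f: "\<And>x y. adj \<epsilon> x y \<Longrightarrow> f x = f y"
    and x: "adj \<epsilon> x x" and y: "adj \<epsilon> y y"
  shows "f x = f y"
proof -
  interpret solid_open "steps \<epsilon>" by (rule solid_open_steps[OF \<epsilon>])
  have "f (point u) = f (point v)" for u v
    by (rule locally_constant_imp_constant[where f = "\<lambda>u. f (point u)"]) (rule f[OF adj_point])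
  then show ?thesis using point_angle x y unfolding adj_def by metis
qed

text \<open>Counts the signed crossings of the half-line of angle 0 by the projection of a 1-chain
  to the \<open>L\<close>th circle.\<close>

definition crossing :: "'i \<Rightarrow> ('i \<Rightarrow> real \<times> real) list \<Rightarrow> 'k::field" where
  "crossing L l = of_bool (angle ((l ! 0) L) - angle ((l ! 1) L) > pi)"

lemma crossing_pair: "crossing L [x, y] = of_bool (angle (x L) - angle (y L) > pi)"
  by (simp add: crossing_def)

text \<open>A cocycle lifts to a coboundary on the universal cover.  The period of the potential in a
  direction in which an inscribed equilateral triangle is a simplex vanishes.\<close>

lemma torus_cocycle:
  fixes g :: "('i \<Rightarrow> real \<times> real) \<Rightarrow> ('i \<Rightarrow> real \<times> real) \<Rightarrow> 'k::field"
  assumes L: "L \<in> I" and \<epsilon>: "\<epsilon> L > 0" "\<And>i. i \<in> I - {L} \<Longrightarrow> sqrt 3 * r i < \<epsilon> i"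
    and g: "\<And>x y z. adj \<epsilon> x y \<Longrightarrow> adj \<epsilon> y z \<Longrightarrow> adj \<epsilon> x z \<Longrightarrow> g x y + g y z = g x z"
  shows "\<exists>a h. (sqrt 3 * r L < \<epsilon> L \<longrightarrow> a = 0) \<and> (\<forall>x y. adj \<epsilon> x y \<longrightarrow>
    g x y = a * (crossing L [x, y] - crossing L [y, x]) + (h y - h x))"
proof -
  have pos: "\<epsilon> i > 0" if "i \<in> I" for i
    using \<epsilon>(1) \<epsilon>(2)[of i] r[OF that] that by (cases "i = L") (auto intro: le_less_trans[rotated])
  interpret solid_open "steps \<epsilon>" by (rule solid_open_steps[OF pos])
  interpret clique "adj \<epsilon>" by (rule clique_adj)
  define G where "G u v = g (point u) (point v)" for u v
  have "G u v + G v w = G u w" if "v - u \<in> steps \<epsilon>" "w - v \<in> steps \<epsilon>" "w - u \<in> steps \<epsilon>" for u v w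
    unfolding G_def using that by (intro g adj_point)
  then obtain H where H: "\<And>u v. v - u \<in> steps \<epsilon> \<Longrightarrow> G u v = H v - H u"
    using cocycle_potential[of G] by blast
  \<comment> \<open>These are the possible values of \<open>wind\<close>: angles are taken in a
    single turn, so an edge needs at most one turn of correction in each coordinate.\<close>
  define unit where "unit = {k :: 'i \<Rightarrow> real. \<forall>i. k i \<in> {-1, 0, 1}}"
  have point_per: "point (u + scl (2 * pi) k) = point u" if "k \<in> unit" for u k
  proof -
    have "circ (r i) (u i + 2 * pi * k i) = circ (r i) (u i)" for i
      using that by (intro circ_periodic) (auto simp: unit_def)
    then show ?thesis by (simp add: point_def fun_eq_iff restrict_def)
  qed
  define \<Lambda> where "\<Lambda> k = H (scl (2 * pi) k) - H 0" for k
  have \<Lambda>: "H (u + scl (2 * pi) k) - H u = \<Lambda> k" if "k \<in> unit" for u k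
    unfolding \<Lambda>_def by (rule period_constant[OF H]) (simp_all only: G_def point_per[OF that])
  \<comment> \<open>The loop in direction \<open>k\<close> is walked in three edges, each a third of
    a turn in the coordinates where \<open>k\<close> is nonzero. Its three vertices are pairwise
    adjacent and hence span a triangle, so the sum of \<open>g\<close> around the loop is 0.
    Upstairs this sum is the period.\<close>
  have kill: "\<Lambda> k = 0" if k: "k \<in> unit" and big: "\<And>i. i \<in> I \<Longrightarrow> k i \<noteq> 0 \<Longrightarrow> sqrt 3 * r i < \<epsilon> i" for k
  proof -
    let ?d = "scl (2 * pi / 3) k"
    define p where "p j = scl (2 * pi / 3 * real j) k" for j
    have d: "?d \<in> steps \<epsilon>"
      unfolding steps_def
    proof (intro CollectI ballI)
      fix i assume i: "i \<in> I"
      have "chord (r i) (?d i) \<le> chord (r i) (2 * pi / 3)" if "k i \<noteq> 0"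
      proof (rule chord_mono[OF r[OF i]])
        have "k i \<in> {-1, 0, 1}" using k unfolding unit_def by blast
        then show "\<bar>?d i\<bar> \<le> \<bar>2 * pi / 3\<bar>" by auto
      qed
      then show "chord (r i) (?d i) < \<epsilon> i"
        using big[OF i] pos[OF i] by (cases "k i = 0") (auto simp: chord_third)
    qed
    have step: "p (Suc j) - p j = ?d" for j
      by (simp add: p_def fun_eq_iff field_simps)
    have adj: "adj \<epsilon> (point (p j)) (point (p (Suc j)))"
      and H': "g (point (p j)) (point (p (Suc j))) = H (p (Suc j)) - H (p j)" for j
      using adj_point[of "p (Suc j)" "p j" \<epsilon>] H[of "p (Suc j)" "p j"] d by (auto simp: step G_def)
    have p3: "p 3 = 0 + scl (2 * pi) k" "p 0 = 0" by (simp_all add: p_def fun_eq_iff)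
    then have close: "point (p 3) = point (p 0)" by (simp only: point_per[OF k])
    have adj3: "adj \<epsilon> (point (p 0)) (point (p 1))" "adj \<epsilon> (point (p 1)) (point (p 2))"
        "adj \<epsilon> (point (p 2)) (point (p 0))"
      using adj[of 0] adj[of 1] adj[of 2] close by (simp_all add: numeral_2_eq_2 numeral_3_eq_3)
    have g0: "g x x = 0" if "adj \<epsilon> x x" for x using g[OF that that that] by (metis add_cancel_right_right)
    have "g (point (p 0)) (point (p 1)) + g (point (p 1)) (point (p 2)) + g (point (p 2)) (point (p 0))
        = g (point (p 0)) (point (p 2)) + g (point (p 2)) (point (p 0))"
      using g[OF adj3(1,2) sym[OF adj3(3)]] by simp
    also have "\<dots> = g (point (p 0)) (point (p 0))"
      using g[OF sym[OF adj3(3)] adj3(3)] vertex[OF adj3(1)] by blast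
    also have "\<dots> = 0" by (rule g0[OF vertex[OF adj3(1)]])
    finally have "H (p 3) - H (p 0) = 0"
      using H'[of 0] H'[of 1] H'[of 2] close by (simp add: numeral_2_eq_2 numeral_3_eq_3)
    then show ?thesis using p3 by (simp add: \<Lambda>_def)
  qed
  let ?e = "(\<lambda>_. 0)(L := 1) :: 'i \<Rightarrow> real"
  \<comment> \<open>Additivity splits off the \<open>L\<close>th coordinate, and the period of the
    remaining direction is killed because all other scales are large. If \<open>k L = -1\<close>,
    the same splitting is read backwards, from \<open>k\<close> plus the unit vector.\<close>
  have decomp: "\<Lambda> k = of_bool (k L = 1) * \<Lambda> ?e - of_bool (k L = -1) * \<Lambda> ?e" if k: "k \<in> unit" for k
  proof -
    let ?k = "k(L := 0)"
    have k': "?k \<in> unit" "?e \<in> unit" using k by (auto simp: unit_def)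
    have zero: "\<Lambda> ?k = 0" using \<epsilon>(2) by (intro kill k') (auto split: if_splits)
    consider "k L = 0" | "k L = 1" | "k L = -1" using k by (auto simp: unit_def)
    then show ?thesis
    proof cases
      case 1
      then have "?k = k" by auto
      then show ?thesis using zero 1 by simp
    next
      case 2
      then have "scl (2 * pi) k = scl (2 * pi) ?k + scl (2 * pi) ?e" by (auto simp: fun_eq_iff)
      then have "\<Lambda> k = \<Lambda> ?k + \<Lambda> ?e"
        using \<Lambda>[OF k'(2), of "scl (2 * pi) ?k"] by (simp add: \<Lambda>_def algebra_simps)
      then show ?thesis using zero 2 by simp
    next
      case 3
      then have "scl (2 * pi) ?k = scl (2 * pi) k + scl (2 * pi) ?e" by (auto simp: fun_eq_iff)
      then have "\<Lambda> ?k = \<Lambda> k + \<Lambda> ?e"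
        using \<Lambda>[OF k'(2), of "scl (2 * pi) k"] by (simp add: \<Lambda>_def algebra_simps)
      then show ?thesis using zero 3 by (simp add: eq_neg_iff_add_eq_0)
    qed
  qed
  \<comment> \<open>The potential is restricted to the fundamental domain of angles. As
    \<open>H\<close> need not be periodic, an edge that leaves this domain also contributes the
    period of the turns it makes.\<close>
  define h where "h x = H (\<lambda>i. angle (x i))" for x :: "'i \<Rightarrow> real \<times> real"
  have "g x y = \<Lambda> ?e * (crossing L [x, y] - crossing L [y, x]) + (h y - h x)" if A: "adj \<epsilon> x y" for x y
  proof -
    have X: "x \<in> (\<Pi>\<^sub>E i\<in>I. sphere 0 (r i))" "y \<in> (\<Pi>\<^sub>E i\<in>I. sphere 0 (r i))"
      using A by (auto simp: adj_def)
    define k where "k i = wind (x i) (y i)" for i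
    let ?u = "\<lambda>i. angle (x i)" and ?w = "\<lambda>i. angle (y i)"
    let ?v = "?w + scl (2 * pi) k"
    have k: "k \<in> unit" using wind_cases by (auto simp: unit_def k_def)
    have pu: "point ?u = x" and pv: "point ?v = y"
      using point_angle X point_per[OF k] by auto
    have "chord (r i) ((?v - ?u) i) < \<epsilon> i" if i: "i \<in> I" for i
    proof -
      have "dist (point ?u i) (point ?v i) = chord (r i) (?v i - ?u i)"
        using i wind_lift[of "y i" "x i"] r[OF i] unfolding point_def
        by (simp only: restrict_apply' k_def plus_fun_apply scl_apply) (rule dist_circ_eq_chord)
      moreover have "dist (x i) (y i) < \<epsilon> i" using A i unfolding adj_def by blast
      ultimately show ?thesis unfolding pu pv by simp
    qed
    then have "?v - ?u \<in> steps \<epsilon>" unfolding steps_def by blast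
    from H[OF this] have "g x y = H ?v - H ?u" unfolding G_def pu pv .
    also have "\<dots> = \<Lambda> k + (h y - h x)" unfolding h_def \<Lambda>[OF k, of ?w, symmetric] by (simp add: algebra_simps)
    also have "\<Lambda> k = \<Lambda> ?e * (crossing L [x, y] - crossing L [y, x])"
      unfolding decomp[OF k] crossing_pair by (auto simp: k_def wind_def)
    finally show ?thesis .
  qed
  moreover have "\<Lambda> ?e = 0" if "sqrt 3 * r L < \<epsilon> L"
    using that by (intro kill) (auto simp: unit_def split: if_splits)
  ultimately show ?thesis by blast
qed

end

section \<open>Barcodes of the torus\<close>

text \<open>The boundaries of consecutive edges telescope. Consecutive vertices may coincide, as the
  degenerate oriented edge is 0.\<close>

lemma path_chain:
  fixes \<phi> :: "'v list \<Rightarrow> 'k::field"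
  assumes "\<And>j. j < m \<Longrightarrow> {v j, v (Suc j)} \<in> K"
  shows "(\<Sum>j<m. oedge (v j) (v (Suc j)) :: 'v list \<Rightarrow> 'k) \<in> simplicial_chains K 1 \<and>
    simplicial_boundary (\<Sum>j<m. oedge (v j) (v (Suc j))) = (single [v m] - single [v 0] :: _ \<Rightarrow> 'k) \<and>
    pairing \<phi> (\<Sum>j<m. oedge (v j) (v (Suc j))) = (\<Sum>j<m. \<phi> [v j, v (Suc j)] - \<phi> [v (Suc j), v j])"
  using assms
proof (induction m)
  case 0
  show ?case
    unfolding lessThan_0 sum.empty
    by (simp only: simplicial_chains_0 boundary_0 diff_self fin_linear_0[OF fin_linear_pairing] simp_thms)
next
  case (Suc m)
  let ?c = "\<Sum>j<m. oedge (v j) (v (Suc j)) :: 'v list \<Rightarrow> 'k" and ?e = "oedge (v m) (v (Suc m)) :: 'v list \<Rightarrow> 'k"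
  have IH: "?c \<in> simplicial_chains K 1" "simplicial_boundary ?c = single [v m] - single [v 0]"
      "pairing \<phi> ?c = (\<Sum>j<m. \<phi> [v j, v (Suc j)] - \<phi> [v (Suc j), v j])"
    using Suc by auto
  have e: "?e \<in> simplicial_chains K 1"
  proof (cases "v m = v (Suc m)")
    case False
    then show ?thesis using Suc.prems[of m] by (intro oedge_in_chains) auto
  qed (simp add: simplicial_chains_0)
  have "?c + scl 1 ?e \<in> simplicial_chains K 1" by (rule simplicial_chains_lincomb[OF IH(1) e])
  moreover have "scl 1 ?e = ?e" by (simp add: fun_eq_iff)
  ultimately have 1: "?c + ?e \<in> simplicial_chains K 1" by (simp only:)
  have fin: "finsupp ?c" using simplicial_chainsD(1)[OF IH(1)] .
  have 2: "simplicial_boundary (?c + ?e) = single [v (Suc m)] - single [v 0]"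
    unfolding boundary_add[OF fin finsupp_oedge] IH(2) boundary_oedge by simp
  have 3: "pairing \<phi> (?c + ?e)
      = (\<Sum>j<m. \<phi> [v j, v (Suc j)] - \<phi> [v (Suc j), v j]) + (\<phi> [v m, v (Suc m)] - \<phi> [v (Suc m), v m])"
    unfolding fin_linear_add[OF fin_linear_pairing fin finsupp_oedge] IH(3)
    by (simp add: oedge_def fin_linear_diff[OF fin_linear_pairing])
  show ?case unfolding sum.lessThan_Suc using 1 2 3 by blast
qed

lemma simplicial_chains_empty: "c \<in> simplicial_chains {} n \<Longrightarrow> c = 0"
  by (auto simp: simplicial_chains_def fun_eq_iff)

text \<open>An identity between integers holds in a field of any characteristic. The winding
  identity is proved in the reals because its proof compares sizes.\<close>

lemma of_bool_transfer:
  assumes "(of_bool a - of_bool b) + (of_bool c - of_bool d) = (of_bool e - of_bool f :: real)"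
  shows "(of_bool a - of_bool b) + (of_bool c - of_bool d) = (of_bool e - of_bool f :: 'k::field)"
  using assms by (cases a; cases b; cases c; cases d; cases e; cases f; simp)

context torus
begin

lemma clique_complex_adj_empty:
  assumes "i \<in> I" "\<epsilon> i \<le> 0" shows "clique_complex (adj \<epsilon>) = {}"
proof -
  have "\<not> adj \<epsilon> x x" for x using assms by (force simp: adj_def)
  then show ?thesis unfolding clique_complex_def by blast
qed

lemma cycle_empty_imp_boundary:
  assumes "i \<in> I" "\<epsilon> i \<le> 0" "z \<in> simplicial_cycles (clique_complex (adj \<epsilon>)) n"
  shows "z \<in> simplicial_boundaries (clique_complex (adj \<epsilon>)) n"
proof -
  have "z \<in> simplicial_chains {} n"
    using assms(3) unfolding clique_complex_adj_empty[of i \<epsilon>, OF assms(1,2)] by (simp add: simplicial_cycles_iff)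
  then have "z = 0" by (rule simplicial_chains_empty)
  then show ?thesis by (simp only: simplicial_boundaries_0)
qed

text \<open>If some scale is not positive, there are no vertices at all. Otherwise short steps
  connect the whole torus, and the augmentation detects the one class.\<close>

lemma barcode_torus_0:
  assumes mono: "\<And>s t i. s \<le> t \<Longrightarrow> i \<in> I \<Longrightarrow> \<epsilon> s i \<le> \<epsilon> t i"
    and J: "is_interval J" "\<And>t. t \<in> J \<longleftrightarrow> (\<forall>i\<in>I. \<epsilon> t i > 0)"
  shows "barcode TYPE('k::field) 0 (\<lambda>t. clique_complex (adj (\<epsilon> t))) = (if J = {} then {#} else {#J#})"
proof (rule interval_homology.barcode_eq[where \<phi> = "\<lambda>_. 1"], unfold_locales)
  fix s t :: real assume "s \<le> t"
  then show "clique_complex (adj (\<epsilon> s)) \<subseteq> clique_complex (adj (\<epsilon> t))"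
    using mono by (intro clique_complex_mono) (blast intro: adj_mono)
next
  show "is_interval J" by (rule J)
next
  fix t and z :: "('i \<Rightarrow> real \<times> real) list \<Rightarrow> 'k"
  assume "t \<notin> J" and z: "z \<in> simplicial_cycles (clique_complex (adj (\<epsilon> t))) 0"
  then obtain i where i: "i \<in> I" "\<epsilon> t i \<le> 0" using J(2)[of t] by (auto simp: not_less)
  then show "z \<in> simplicial_boundaries (clique_complex (adj (\<epsilon> t))) 0"
    using z by (rule cycle_empty_imp_boundary)
next
  fix t and z :: "('i \<Rightarrow> real \<times> real) list \<Rightarrow> 'k"
  assume t: "t \<in> J" and z: "z \<in> simplicial_cycles (clique_complex (adj (\<epsilon> t))) 0"
  then have pos: "\<epsilon> t i > 0" if "i \<in> I" for i using J(2) that by blast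
  show "z \<in> simplicial_boundaries (clique_complex (adj (\<epsilon> t))) 0 \<longleftrightarrow> pairing (\<lambda>_. 1) z = 0"
  proof (rule clique.boundaries_0_iff[OF clique_adj])
    fix f :: "('i \<Rightarrow> real \<times> real) \<Rightarrow> 'k" and x y
    assume "\<And>x y. adj (\<epsilon> t) x y \<Longrightarrow> f x = f y" "adj (\<epsilon> t) x x" "adj (\<epsilon> t) y y"
    with pos show "f x = f y" by (rule adj_connected)
  qed (use z in \<open>simp add: simplicial_cycles_iff\<close>)
next
  fix t assume t: "t \<in> J"
  then have "adj (\<epsilon> t) (point 0) (point 0)"
    using J(2)[of t] by (intro adj_point) (simp add: steps_def)
  then have "{point 0} \<in> clique_complex (adj (\<epsilon> t))" by (simp add: clique_complex_def)
  then have "single [point 0] \<in> simplicial_cycles (clique_complex (adj (\<epsilon> t))) 0"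
    by (simp add: simplicial_cycles_iff single_in_chains boundary_single)
  then show "\<exists>z\<in>simplicial_cycles (clique_complex (adj (\<epsilon> t))) 0. pairing (\<lambda>_. 1) z = (1 :: 'k)"
    by (rule bexI[rotated]) simp
qed

text \<open>The generator is a regular polygon that runs once around the \<open>L\<close>th circle,
  with the other angles fixed at 0. Only its closing edge crosses the cut, so the pairing is
  1.\<close>

lemma crossing_cycle:
  assumes L: "L \<in> I" and rL: "r L > 0" and \<epsilon>: "\<And>i. i \<in> I \<Longrightarrow> \<epsilon> i > 0"
  shows "\<exists>z\<in>simplicial_cycles (clique_complex (adj \<epsilon>)) 1. pairing (crossing L) z = (1 :: 'k::field)"
proof -
  interpret solid_open "steps \<epsilon>" by (rule solid_open_steps[OF \<epsilon>])
  let ?e = "(\<lambda>_. 0)(L := 2 * pi)"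
  \<comment> \<open>The bound \<open>2 \<le> n\<close> gives at least four vertices. With two, the
    closing edge would drop by exactly half a turn, which \<open>crossing\<close> does not
    count.\<close>
  have "\<forall>\<^sub>F n in sequentially. scl (1 / 2 ^ n) ?e \<in> steps \<epsilon> \<and> 2 \<le> n"
    by (intro eventually_conj eventually_small eventually_ge_at_top)
  then obtain m where m: "scl (1 / 2 ^ m) ?e \<in> steps \<epsilon>" "2 \<le> m"
    using eventually_happens by force
  define n :: nat where "n = 2 ^ m"
  have n4: "n \<ge> 4" using power_increasing[OF m(2), of "2 :: nat"] by (simp add: n_def)
  define v where "v j = point (scl (real j / real n) ?e)" for j
  have adj_v: "adj \<epsilon> (v j) (v (Suc j))" for j
  proof -
    have "scl (real (Suc j) / real n) ?e - scl (real j / real n) ?e = scl (1 / 2 ^ m) ?e"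
      by (auto simp: fun_eq_iff n_def field_simps)
    then show ?thesis unfolding v_def using m by (intro adj_point) (simp only:)
  qed
  have vL: "v j L = circ (r L) (2 * pi * real j / real n)" for j
    using L by (simp add: v_def point_def mult.commute)
  have angle_v: "angle (v j L) = 2 * pi * real j / real n" if "j < n" for j
    unfolding vL using rL n4 that by (intro angle_circ) (auto simp: field_simps)
  have "circ (r i) (scl (real n / real n) ?e i) = circ (r i) (scl (real 0 / real n) ?e i)" for i
    using n4 by (simp add: circ_def)
  then have close: "v n = v 0" by (simp only: v_def point_def)
  have closed_angle: "angle (v n L) = 0" using close angle_v[of 0] n4 by simp
  let ?\<delta> = "\<lambda>j. crossing L [v j, v (Suc j)] - crossing L [v (Suc j), v j] :: 'k"
  have "?\<delta> j = 0" if j: "j < n - 1" for j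
  proof -
    have "angle (v (Suc j) L) - angle (v j L) = 2 * pi / real n"
      using angle_v[of j] angle_v[of "Suc j"] j by (simp add: field_simps)
    moreover have "2 * pi / real n \<le> pi" using n4 by (simp add: field_simps)
    moreover have "2 * pi / real n \<ge> 0" by simp
    ultimately have "\<not> angle (v j L) - angle (v (Suc j) L) > pi" "\<not> angle (v (Suc j) L) - angle (v j L) > pi"
      using pi_gt_zero by linarith+
    then show ?thesis by (simp add: crossing_def)
  qed
  moreover have "?\<delta> (n - 1) = 1"
  proof -
    have "angle (v (n - 1) L) = 2 * pi - 2 * pi / real n"
      using angle_v[of "n - 1"] n4 by (simp add: field_simps of_nat_diff)
    moreover have "2 * pi / real n \<le> 2 * pi / 4" using n4 by (intro divide_left_mono) auto
    moreover have n1: "Suc (n - 1) = n" using n4 by simp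
    ultimately have gt: "angle (v (n - 1) L) - angle (v (Suc (n - 1)) L) > pi"
      unfolding n1 closed_angle using pi_gt_zero by linarith
    then have "\<not> angle (v (Suc (n - 1)) L) - angle (v (n - 1) L) > pi" using pi_gt_zero by linarith
    with gt show ?thesis by (simp add: crossing_def)
  qed
  moreover have "{..<n} = insert (n - 1) {..<n - 1}" using n4 by auto
  ultimately have sum: "(\<Sum>j<n. ?\<delta> j) = 1" by simp
  have "{v j, v (Suc j)} \<in> clique_complex (adj \<epsilon>)" for j
    using adj_v clique.edge[OF clique_adj] by blast
  then have "(\<Sum>j<n. oedge (v j) (v (Suc j)) :: _ \<Rightarrow> 'k) \<in> simplicial_chains (clique_complex (adj \<epsilon>)) 1 \<and>
      simplicial_boundary (\<Sum>j<n. oedge (v j) (v (Suc j))) = (single [v n] - single [v 0] :: _ \<Rightarrow> 'k) \<and>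
      pairing (crossing L) (\<Sum>j<n. oedge (v j) (v (Suc j))) = (\<Sum>j<n. ?\<delta> j)"
    by (rule path_chain)
  then show ?thesis
    unfolding sum close diff_self
    by (intro bexI[of _ "\<Sum>j<n. oedge (v j) (v (Suc j))"]) (blast, simp only: simplicial_cycles_iff)
qed

text \<open>Before \<open>J\<close> the complex is empty, and after \<open>J\<close> even the period
  in direction \<open>L\<close> is killed. In between, \<open>wind_triangle\<close> makes the
  crossing count a cocycle, \<open>torus_cocycle\<close> shows that it spans the cohomology, and the
  polygon shows that it is nontrivial.\<close>

lemma barcode_torus_1:
  assumes L: "L \<in> I" and mono: "\<And>s t i. s \<le> t \<Longrightarrow> i \<in> I \<Longrightarrow> \<epsilon> s i \<le> \<epsilon> t i"
    and J: "is_interval J" "\<And>t. t \<in> J \<longleftrightarrow> \<epsilon> t L > 0 \<and> \<epsilon> t L \<le> sqrt 3 * r L"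
    and big: "\<And>t i. \<epsilon> t L > 0 \<Longrightarrow> i \<in> I - {L} \<Longrightarrow> sqrt 3 * r i < \<epsilon> t i"
  shows "barcode TYPE('k::field) 1 (\<lambda>t. clique_complex (adj (\<epsilon> t))) = (if J = {} then {#} else {#J#})"
proof (rule interval_homology.barcode_eq[where \<phi> = "crossing L"], unfold_locales)
  fix s t :: real assume "s \<le> t"
  then show "clique_complex (adj (\<epsilon> s)) \<subseteq> clique_complex (adj (\<epsilon> t))"
    using mono by (intro clique_complex_mono) (blast intro: adj_mono)
next
  show "is_interval J" by (rule J)
next
  fix t and z :: "('i \<Rightarrow> real \<times> real) list \<Rightarrow> 'k"
  assume t: "t \<notin> J" and z: "z \<in> simplicial_cycles (clique_complex (adj (\<epsilon> t))) 1"
  show "z \<in> simplicial_boundaries (clique_complex (adj (\<epsilon> t))) 1"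
  proof (cases "\<epsilon> t L > 0")
    case False
    then show ?thesis using cycle_empty_imp_boundary[OF L _ z] by simp
  next
    case True
    then have large: "sqrt 3 * r L < \<epsilon> t L" using t J(2) by auto
    show ?thesis
    \<comment> \<open>With \<open>\<phi>\<close> zero the remaining obligation is that every cocycle
      is a coboundary.\<close>
    proof (rule clique.cycle_imp_boundary_1[OF clique_adj _ z, where \<phi> = "\<lambda>_. 0"])
      fix g :: "('i \<Rightarrow> real \<times> real) \<Rightarrow> ('i \<Rightarrow> real \<times> real) \<Rightarrow> 'k"
      assume g: "\<And>x y z. adj (\<epsilon> t) x y \<Longrightarrow> adj (\<epsilon> t) y z \<Longrightarrow> adj (\<epsilon> t) x z \<Longrightarrow> g x y + g y z = g x z"
      have "\<exists>a h. (sqrt 3 * r L < \<epsilon> t L \<longrightarrow> a = 0) \<and> (\<forall>x y. adj (\<epsilon> t) x y \<longrightarrow>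
          g x y = a * (crossing L [x, y] - crossing L [y, x]) + (h y - h x))"
        by (rule torus_cocycle[where \<epsilon> = "\<epsilon> t", OF L True]) (rule big[OF True], assumption, rule g)
      then show "\<exists>a h. \<forall>x y. adj (\<epsilon> t) x y \<longrightarrow> g x y = a * (0 - 0) + (h y - h x)"
        using large by auto
    qed (simp add: pairing_def)
  qed
next
  fix t and z :: "('i \<Rightarrow> real \<times> real) list \<Rightarrow> 'k"
  assume t: "t \<in> J" and z: "z \<in> simplicial_cycles (clique_complex (adj (\<epsilon> t))) 1"
  have pos: "\<epsilon> t L > 0" and small: "\<epsilon> t L \<le> sqrt 3 * r L" using t J(2) by auto
  \<comment> \<open>A circle of radius 0 leaves no room between birth and death, so a parameter in
    \<open>J\<close> forces a positive radius.\<close>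
  have rL: "r L > 0" using pos small r[OF L] by (cases "r L = 0") auto
  have "pairing (crossing L) c = 0" if "c \<in> simplicial_boundaries (clique_complex (adj (\<epsilon> t))) 1"
    for c :: "('i \<Rightarrow> real \<times> real) list \<Rightarrow> 'k"
  proof (rule clique.boundary_pairing_eq_0[OF clique_adj _ that])
    fix x y z assume A: "adj (\<epsilon> t) x y" "adj (\<epsilon> t) y z" "adj (\<epsilon> t) x z"
    have "wind (x L) (y L) + wind (y L) (z L) = wind (x L) (z L)"
    proof (rule wind_triangle[OF rL])
      show "norm (x L) = r L" "norm (y L) = r L" "norm (z L) = r L"
        using A PiE_mem[OF _ L] unfolding adj_def by fastforce+
      show "dist (x L) (y L) < sqrt 3 * r L" "dist (y L) (z L) < sqrt 3 * r L" "dist (x L) (z L) < sqrt 3 * r L"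
        using A L small unfolding adj_def by (meson less_le_trans)+
    qed
    then show "crossing L [x, y] - crossing L [y, x] + (crossing L [y, z] - crossing L [z, y])
        = (crossing L [x, z] - crossing L [z, x] :: 'k)"
      unfolding wind_def crossing_pair by (rule of_bool_transfer)
  qed
  moreover have "z \<in> simplicial_boundaries (clique_complex (adj (\<epsilon> t))) 1" if "pairing (crossing L) z = 0"
  proof (rule clique.cycle_imp_boundary_1[OF clique_adj _ z that])
    fix g :: "('i \<Rightarrow> real \<times> real) \<Rightarrow> ('i \<Rightarrow> real \<times> real) \<Rightarrow> 'k"
    assume g: "\<And>x y z. adj (\<epsilon> t) x y \<Longrightarrow> adj (\<epsilon> t) y z \<Longrightarrow> adj (\<epsilon> t) x z \<Longrightarrow> g x y + g y z = g x z"
    have "\<exists>a h. (sqrt 3 * r L < \<epsilon> t L \<longrightarrow> a = 0) \<and> (\<forall>x y. adj (\<epsilon> t) x y \<longrightarrow>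
        g x y = a * (crossing L [x, y] - crossing L [y, x]) + (h y - h x))"
      by (rule torus_cocycle[where \<epsilon> = "\<epsilon> t", OF L pos]) (rule big[OF pos], assumption, rule g)
    then show "\<exists>a h. \<forall>x y. adj (\<epsilon> t) x y \<longrightarrow>
        g x y = a * (crossing L [x, y] - crossing L [y, x]) + (h y - h x)"
      by blast
  qed
  ultimately show "z \<in> simplicial_boundaries (clique_complex (adj (\<epsilon> t))) 1 \<longleftrightarrow> pairing (crossing L) z = 0"
    by blast
next
  fix t assume t: "t \<in> J"
  have pos: "\<epsilon> t L > 0" and small: "\<epsilon> t L \<le> sqrt 3 * r L" using t J(2) by auto
  have rL: "r L > 0" using pos small r[OF L] by (cases "r L = 0") auto
  have "\<epsilon> t i > 0" if "i \<in> I" for i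
    using pos big[OF pos, of i] r[OF that] that by (cases "i = L") (auto intro: le_less_trans[rotated])
  then show "\<exists>z\<in>simplicial_cycles (clique_complex (adj (\<epsilon> t))) 1. pairing (crossing L) z = (1 :: 'k)"
    by (rule crossing_cycle[OF L rL])
qed

section \<open>Products of Rips complexes as clique complexes\<close>

text \<open>Both the Rips condition and the product condition can be tested on pairs of points, one
  coordinate at a time, so the product is again determined by its edges.\<close>

lemma product_rips_eq_clique_complex:
  "product_complex I (\<lambda>i. vietoris_rips (\<epsilon> i) ((\<lambda>x. x i) ` (\<Pi>\<^sub>E i\<in>I. sphere 0 (r i))))
    = clique_complex (adj \<epsilon>)"
proof -
  \<comment> \<open>A point of one circle is completed to a point of the torus by angle 0 in the
    other coordinates.\<close>
  have proj: "(\<lambda>x. x i) ` (\<Pi>\<^sub>E i\<in>I. sphere 0 (r i)) = sphere (0 :: real \<times> real) (r i)" if i: "i \<in> I" for i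
  proof (intro equalityI subsetI)
    fix p :: "real \<times> real" assume "p \<in> sphere 0 (r i)"
    then have "(point 0)(i := p) \<in> (\<Pi>\<^sub>E i\<in>I. sphere 0 (r i))"
      using point_in_torus[of 0] i by (auto simp: PiE_iff extensional_def)
    then show "p \<in> (\<lambda>x. x i) ` (\<Pi>\<^sub>E i\<in>I. sphere 0 (r i))" by (rule image_eqI[rotated]) simp
  qed (use i in auto)
  let ?S = "\<lambda>i. sphere (0 :: real \<times> real) (r i)"
  have rips: "\<Union> (vietoris_rips e X) \<subseteq> X" for e and X :: "(real \<times> real) set"
    by (auto simp: vietoris_rips_def)
  have "product_complex I (\<lambda>i. vietoris_rips (\<epsilon> i) ((\<lambda>x. x i) ` (\<Pi>\<^sub>E i\<in>I. ?S i)))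
      = product_complex I (\<lambda>i. vietoris_rips (\<epsilon> i) (?S i))"
    unfolding product_complex_def by (simp add: proj cong: PiE_cong)
  also have "\<dots> = clique_complex (adj \<epsilon>)"
  proof (intro equalityI subsetI)
    fix \<sigma> assume \<sigma>: "\<sigma> \<in> product_complex I (\<lambda>i. vietoris_rips (\<epsilon> i) (?S i))"
    then have "\<sigma> \<subseteq> (\<Pi>\<^sub>E i\<in>I. \<Union> (vietoris_rips (\<epsilon> i) (?S i)))" by (simp add: product_complex_def)
    also have "\<dots> \<subseteq> (\<Pi>\<^sub>E i\<in>I. ?S i)" by (intro PiE_mono rips)
    finally have "\<sigma> \<subseteq> (\<Pi>\<^sub>E i\<in>I. ?S i)" .
    moreover have "dist (x i) (y i) < \<epsilon> i" if "x \<in> \<sigma>" "y \<in> \<sigma>" "i \<in> I" for x y i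
    proof -
      have "(\<lambda>x. x i) ` \<sigma> \<in> vietoris_rips (\<epsilon> i) (?S i)" using \<sigma> that(3) by (simp add: product_complex_def)
      then show ?thesis using that unfolding vietoris_rips_def by blast
    qed
    moreover have "finite \<sigma>" "\<sigma> \<noteq> {}" using \<sigma> by (simp_all add: product_complex_def)
    ultimately show "\<sigma> \<in> clique_complex (adj \<epsilon>)"
      unfolding clique_complex_def adj_def by blast
  next
    fix \<sigma> assume \<sigma>: "\<sigma> \<in> clique_complex (adj \<epsilon>)"
    have fin: "finite \<sigma>" "\<sigma> \<noteq> {}" using \<sigma> by (simp_all add: clique_complex_def)
    have A: "adj \<epsilon> x y" if "x \<in> \<sigma>" "y \<in> \<sigma>" for x y
      using \<sigma> that unfolding clique_complex_def by blast
    have S: "x i \<in> ?S i" if "x \<in> \<sigma>" "i \<in> I" for x i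
      using A[OF that(1) that(1)] that(2) unfolding adj_def by (blast dest: PiE_mem)
    have VR: "(\<lambda>x. x i) ` \<sigma> \<in> vietoris_rips (\<epsilon> i) (?S i)" if i: "i \<in> I" for i
    proof -
      have "\<forall>p\<in>(\<lambda>x. x i) ` \<sigma>. \<forall>q\<in>(\<lambda>x. x i) ` \<sigma>. dist p q < \<epsilon> i"
        using A i unfolding adj_def by blast
      moreover have "(\<lambda>x. x i) ` \<sigma> \<subseteq> ?S i" using S i by blast
      ultimately show ?thesis using fin unfolding vietoris_rips_def by blast
    qed
    have "\<sigma> \<subseteq> (\<Pi>\<^sub>E i\<in>I. \<Union> (vietoris_rips (\<epsilon> i) (?S i)))"
    proof
      fix x assume x: "x \<in> \<sigma>"
      then have "x \<in> extensional I" using A[OF x x] unfolding adj_def PiE_iff by blast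
      moreover have "x i \<in> \<Union> (vietoris_rips (\<epsilon> i) (?S i))" if "i \<in> I" for i
        using VR[OF that] x by blast
      ultimately show "x \<in> (\<Pi>\<^sub>E i\<in>I. \<Union> (vietoris_rips (\<epsilon> i) (?S i)))" unfolding PiE_iff by blast
    qed
    then show "\<sigma> \<in> product_complex I (\<lambda>i. vietoris_rips (\<epsilon> i) (?S i))"
      using fin VR unfolding product_complex_def by blast
  qed
  finally show ?thesis .
qed

end

section \<open>The Liouville torus and the associated rays\<close>

lemma torus_radius_nonneg: "torus_radius f L \<ge> 0"
  by (simp add: torus_radius_def)

lemma liouville_torus_eq: "liouville_torus N f = (\<Pi>\<^sub>E i\<in>{1..N}. sphere 0 (torus_radius f i))"
proof -
  have "action i x = (torus_radius f i)\<^sup>2 / 2 \<longleftrightarrow> x i \<in> sphere 0 (torus_radius f i)" for i x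
  proof -
    have "norm (x i) = torus_radius f i \<longleftrightarrow> (norm (x i))\<^sup>2 = (torus_radius f i)\<^sup>2"
      using torus_radius_nonneg by (simp add: power2_eq_iff_nonneg)
    moreover have "(norm (x i))\<^sup>2 = (snd (x i))\<^sup>2 + (fst (x i))\<^sup>2" by (simp add: norm_prod_def)
    ultimately show ?thesis by (auto simp: action_def)
  qed
  then show ?thesis by (simp add: liouville_torus_def PiE_iff set_eq_iff conj_commute)
qed

lemma ray_filtration_liouville_torus:
  "ray_filtration N \<l> (liouville_torus N f) t = clique_complex (torus.adj {1..N} (torus_radius f) (ray_point N \<l> t))"
proof -
  interpret torus "{1..N}" "torus_radius f" by unfold_locales (simp_all add: torus_radius_nonneg)
  show ?thesis unfolding ray_filtration_def liouville_torus_eq by (rule product_rips_eq_clique_complex)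
qed

lemma sum_singleton_mset: "finite A \<Longrightarrow> (\<Sum>i\<in>A. {#f i#}) = image_mset f (mset_set A)"
  by (induction A rule: finite_induct) auto

lemma sum_filter_mset:
  "finite A \<Longrightarrow> (\<Sum>i\<in>A. if P (f i) then {#f i#} else {#}) = filter_mset P (image_mset f (mset_set A))"
  by (induction A rule: finite_induct) auto

theorem theorem4p12:
  fixes f :: "real \<Rightarrow> real" and N :: nat
    and a b :: "nat \<Rightarrow> real" and aL bL :: "nat \<Rightarrow> nat \<Rightarrow> real"
  assumes "N \<ge> 1"
    and "\<forall>x. f (x + 2 * pi) = f x"
    and "\<forall>i\<in>{1..N}. a i > 0"
    and "\<forall>L\<in>{1..N}. \<forall>i\<in>{1..N}. aL L i > 0"
    and "\<forall>L\<in>{1..N}. aL L L = a L"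
    and "\<forall>L\<in>{1..N}. bL L L = b L"
    and "\<forall>L\<in>{1..N}. L2_set (aL L) {1..N} = L2_set a {1..N}"
    and "\<forall>L\<in>{1..N}. \<forall>i\<in>{1..N} - {L}.
           (torus_radius f i * sqrt 3 - bL L i) / (sqrt (real N) * aL L i / L2_set (aL L) {1..N})
             \<le> - b L / (sqrt (real N) * a L / L2_set (aL L) {1..N})"
  shows "bcd_rays TYPE('k::field) 0 N N (\<lambda>L. (aL L, bL L)) (liouville_torus N f) =
           {# {- b L / (sqrt (real N) * a L / L2_set a {1..N}) <..}. L \<in># mset_set {1..N} #}
       \<and> bcd_rays TYPE('k) 1 N N (\<lambda>L. (aL L, bL L)) (liouville_torus N f) =
           filter_mset (\<lambda>I. I \<noteq> {})
             {# {- b L / (sqrt (real N) * a L / L2_set a {1..N}) <..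
                 (torus_radius f L * sqrt 3 - b L) / (sqrt (real N) * a L / L2_set a {1..N})}.
                L \<in># mset_set {1..N} #}"
proof -
  note N = assms(1) and a = assms(3) and aL = assms(4) and aLL = assms(5) and bLL = assms(6)
    and norm = assms(7) and max = assms(8)
  interpret torus "{1..N}" "torus_radius f"
    by unfold_locales (simp_all add: torus_radius_nonneg)
  let ?n = "L2_set a {1..N}"
  let ?c = "\<lambda>i. sqrt (real N) * a i / ?n"
  have "0 < a 1" using a N by simp
  also have "a 1 \<le> ?n" using N by (intro member_le_L2_set) auto
  finally have n: "?n > 0" .
  have c: "?c i > 0" if "i \<in> {1..N}" for i
    using that a n N by simp
  let ?\<epsilon> = "\<lambda>L t. ray_point N (aL L, bL L) t"
  let ?birth = "\<lambda>L. - b L / ?c L" and ?death = "\<lambda>L. (torus_radius f L * sqrt 3 - b L) / ?c L"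
  have mono: "?\<epsilon> L s i \<le> ?\<epsilon> L t i" if "L \<in> {1..N}" "s \<le> t" "i \<in> {1..N}" for L s t i
    using that aL n norm by (simp add: ray_point_def divide_right_mono mult_right_mono mult_left_mono)
  have \<epsilon>L: "?\<epsilon> L t L = b L + t * ?c L" if "L \<in> {1..N}" for L t
    using that aLL bLL norm by (simp add: ray_point_def)
  have birth: "?\<epsilon> L t L > 0 \<longleftrightarrow> t > ?birth L" if "L \<in> {1..N}" for L t
    unfolding \<epsilon>L[OF that] pos_divide_less_eq[OF c[OF that]] by linarith
  have death: "?\<epsilon> L t L \<le> sqrt 3 * torus_radius f L \<longleftrightarrow> t \<le> ?death L" if "L \<in> {1..N}" for L t
    unfolding \<epsilon>L[OF that] pos_le_divide_eq[OF c[OF that]] by (simp add: algebra_simps)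
  \<comment> \<open>By the maximum condition every other scale has reached its triangle side no
    later than the birth time of the \<open>L\<close>th ray. Strictness comes from \<open>t\<close>
    lying beyond this birth.\<close>
  have big: "sqrt 3 * torus_radius f i < ?\<epsilon> L t i"
    if L: "L \<in> {1..N}" and t: "?\<epsilon> L t L > 0" and i: "i \<in> {1..N} - {L}" for L t i
  proof -
    let ?d = "sqrt (real N) * aL L i / ?n"
    have d: "?d > 0" using i L aL n N by simp
    have "(torus_radius f i * sqrt 3 - bL L i) / ?d \<le> ?birth L"
      using max L i norm by simp
    also have "\<dots> < t" using birth[OF L] t by blast
    finally have "torus_radius f i * sqrt 3 - bL L i < t * ?d"
      unfolding pos_divide_less_eq[OF d] .
    moreover have "?\<epsilon> L t i = bL L i + t * ?d"
      using L norm by (simp add: ray_point_def)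
    ultimately show ?thesis unfolding mult.commute[of "sqrt 3"] by linarith
  qed
  have bcd0: "bcd_ray TYPE('k) 0 N (aL L, bL L) (liouville_torus N f) = {#{?birth L <..}#}"
    if L: "L \<in> {1..N}" for L
  proof -
    have "t \<in> {?birth L <..} \<longleftrightarrow> (\<forall>i\<in>{1..N}. ?\<epsilon> L t i > 0)" for t
    proof
      assume "t \<in> {?birth L <..}"
      then have pos: "?\<epsilon> L t L > 0" using birth[OF L] by simp
      show "\<forall>i\<in>{1..N}. ?\<epsilon> L t i > 0"
      proof
        fix i assume i: "i \<in> {1..N}"
        have "0 \<le> sqrt 3 * torus_radius f i" by (simp add: torus_radius_nonneg)
        then show "?\<epsilon> L t i > 0" using pos big[OF L pos, of i] i by (cases "i = L") auto
      qed
    next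
      assume "\<forall>i\<in>{1..N}. ?\<epsilon> L t i > 0"
      then have "?\<epsilon> L t L > 0" using L by blast
      then show "t \<in> {?birth L <..}" unfolding birth[OF L] by simp
    qed
    then have "barcode TYPE('k) 0 (\<lambda>t. clique_complex (adj (?\<epsilon> L t)))
        = (if {?birth L <..} = {} then {#} else {#{?birth L <..}#})"
      using mono[OF L] by (intro barcode_torus_0) (auto simp: is_interval_oi)
    moreover have "{?birth L <..} \<noteq> {}" by (rule greaterThan_non_empty)
    ultimately show ?thesis unfolding bcd_ray_def ray_filtration_liouville_torus by simp
  qed
  \<comment> \<open>Birth and death differ by a positive multiple of the radius. They coincide
    exactly if the radius is 0; the interval is then empty and contributes no bar.\<close>
  have bcd1: "bcd_ray TYPE('k) 1 N (aL L, bL L) (liouville_torus N f)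
      = (if {?birth L <.. ?death L} \<noteq> {} then {#{?birth L <.. ?death L}#} else {#})"
    if L: "L \<in> {1..N}" for L
  proof -
    have "barcode TYPE('k) 1 (\<lambda>t. clique_complex (adj (?\<epsilon> L t)))
        = (if {?birth L <.. ?death L} = {} then {#} else {#{?birth L <.. ?death L}#})"
    proof (rule barcode_torus_1[OF L mono[OF L]])
      show "t \<in> {?birth L <.. ?death L} \<longleftrightarrow> ?\<epsilon> L t L > 0 \<and> ?\<epsilon> L t L \<le> sqrt 3 * torus_radius f L" for t
        unfolding birth[OF L] death[OF L] by simp
    qed (use big[OF L] in \<open>auto simp: is_interval_oc\<close>)
    then show ?thesis unfolding bcd_ray_def ray_filtration_liouville_torus by simp
  qed
  have "bcd_rays TYPE('k) 0 N N (\<lambda>L. (aL L, bL L)) (liouville_torus N f) = (\<Sum>L\<in>{1..N}. {#{?birth L <..}#})"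
    unfolding bcd_rays_def by (rule sum.cong[OF refl bcd0])
  moreover have "bcd_rays TYPE('k) 1 N N (\<lambda>L. (aL L, bL L)) (liouville_torus N f)
      = (\<Sum>L\<in>{1..N}. if {?birth L <.. ?death L} \<noteq> {} then {#{?birth L <.. ?death L}#} else {#})"
    unfolding bcd_rays_def by (rule sum.cong[OF refl bcd1])
  ultimately show ?thesis
    by (simp only: sum_singleton_mset[OF finite_atLeastAtMost] sum_filter_mset[OF finite_atLeastAtMost, where P = "\<lambda>I. I \<noteq> {}"])
qed

end
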